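(* Let $\alpha=\alpha_1\alpha_2\ldots$ be an infinite binary periodic word containing at least one $1$. Then the class $\mathcal{G}_\alpha$ is a minimal hereditary class of graphs of unbounded clique-width, and it is also a minimal hereditary class of graphs of unbounded linear clique-width.
   Context: Graphs are undirected, without loops or multiple edges, and (apart from the infinite graphs $\mathcal{P}$, $\mathcal{P}^\alpha$ below) finite and nonempty. A class of graphs (closed under isomorphism) is hereditary if it is closed under taking induced subgraphs. The clique-width $\mathrm{cwd}(G)$ of a graph $G$ is the minimum number of labels needed to construct $G$ by an expression using the following operations: creation of a new vertex $v$ with label $i$; disjoint union $\oplus$ of two labelled graphs; $\eta_{i,j}$ ($i\neq j$), adding all edges between vertices labelled $i$ and vertices labelled $j$; $\rho_{i\to j}$, renaming label $i$ to label $j$. The linear clique-width $\mathrm{lcwd}(G)$ is the minimum number of labels in such an expression whose associated tree is a caterpillar, i.e. in which every $\oplus$-operation has at least one operand that is a single newly created vertex. A class has unbounded clique-width (respectively, linear clique-width) if there is no constant bounding this parameter on all graphs in the class. A hereditary class $X$ is a minimal hereditary class of unbounded clique-width (respectively, linear clique-width) if it has unbounded clique-width (respectively, linear clique-width) and every hereditary class properly contained in $X$ has bounded clique-width (respectively, linear clique-width). An infinite word $\alpha=\alpha_1\alpha_2\ldots$ is periodic if there is a positive integer $p$ with $\alpha_i=\alpha_{i+p}$ for all $i\geq 1$. Let $\mathbb{N}=\{1,2,\ldots\}$. The graph $\mathcal{P}$ has vertex set $\{v_{i,j}: i,j\in\mathbb{N}\}$ and edge set $\{\{v_{i,j},v_{i,j+1}\}: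 i,j\in\mathbb{N}\}$. Its $j$th column is $V_j=\{v_{i,j}: i\in\mathbb{N}\}$. For an infinite binary word $\alpha$, the graph $\mathcal{P}^\alpha$ is obtained from $\mathcal{P}$ by complementing the edges between $V_j$ and $V_{j+1}$ for exactly those $j$ with $\alpha_j=1$; that is, the only edges are between consecutive columns, and $v_{i,j}$ is adjacent to $v_{k,j+1}$ iff ($\alpha_j=0$ and $i=k$) or ($\alpha_j=1$ and $i\neq k$). The class $\mathcal{G}_\alpha$ consists of all finite induced subgraphs of $\mathcal{P}^\alpha$ (up to isomorphism). *)

theory Defs
  imports
    "Graph_Theory.Pair_Digraph"
    "Graph_Theory.Digraph_Component"
    "Graph_Theory.Digraph_Isomorphism"
begin

section \<open>Graphs and hereditary classes\<close>

text \<open>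
  As in the library, an undirected simple graph is a symmetric loop-free digraph whose arcs are
  pairs of vertices; the locale predicate \<^const>\<open>pair_graph\<close> also requires finiteness. An edge
  \<open>{u, v}\<close> is represented by the two arcs \<open>(u, v)\<close> and \<open>(v, u)\<close>.

  A class of graphs is an isomorphism-closed set of graphs with vertices in \<^typ>\<open>nat\<close>; every finite
  graph has an isomorphic copy of this form.
\<close>

definition fin_graph :: "'a pair_pre_digraph \<Rightarrow> bool" where
  "fin_graph G \<longleftrightarrow> pair_graph G \<and> pverts G \<noteq> {}"

definition induced_in :: "'a pair_pre_digraph \<Rightarrow> 'a pair_pre_digraph \<Rightarrow> bool" where
  "induced_in H G \<longleftrightarrow> induced_subgraph (with_proj H) (with_proj G)"

definition isomorphic :: "'a pair_pre_digraph \<Rightarrow> 'b pair_pre_digraph \<Rightarrow> bool" where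
  "isomorphic G H \<longleftrightarrow> digraph_iso (with_proj G) (with_proj H)"

definition graph_class :: "nat pair_pre_digraph set \<Rightarrow> bool" where
  "graph_class X \<longleftrightarrow>
     (\<forall>G\<in>X. fin_graph G) \<and>
     (\<forall>G\<in>X. \<forall>H. fin_graph H \<and> isomorphic G H \<longrightarrow> H \<in> X)"

definition hereditary :: "nat pair_pre_digraph set \<Rightarrow> bool" where
  "hereditary X \<longleftrightarrow>
     graph_class X \<and> (\<forall>G\<in>X. \<forall>H. fin_graph H \<and> induced_in H G \<longrightarrow> H \<in> X)"

section \<open>Clique-width and linear clique-width\<close>

datatype 'a cw_expr =
    Create 'a nat
  | Disj_Union "'a cw_expr" "'a cw_expr"
  | Join nat nat "'a cw_expr"
  | Relabel nat nat "'a cw_expr"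

primrec cw_verts :: "'a cw_expr \<Rightarrow> 'a set" where
  "cw_verts (Create v i) = {v}"
| "cw_verts (Disj_Union e f) = cw_verts e \<union> cw_verts f"
| "cw_verts (Join i j e) = cw_verts e"
| "cw_verts (Relabel i j e) = cw_verts e"

text \<open>The value of \<open>cw_label e\<close> is only meaningful on \<open>cw_verts e\<close>.\<close>

primrec cw_label :: "'a cw_expr \<Rightarrow> 'a \<Rightarrow> nat" where
  "cw_label (Create v i) = (\<lambda>_. i)"
| "cw_label (Disj_Union e f) = (\<lambda>u. if u \<in> cw_verts e then cw_label e u else cw_label f u)"
| "cw_label (Join i j e) = cw_label e"
| "cw_label (Relabel i j e) = (\<lambda>u. if cw_label e u = i then j else cw_label e u)"

primrec cw_arcs :: "'a cw_expr \<Rightarrow> 'a rel" where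
  "cw_arcs (Create v i) = {}"
| "cw_arcs (Disj_Union e f) = cw_arcs e \<union> cw_arcs f"
| "cw_arcs (Join i j e) = cw_arcs e \<union>
     {(u, v). u \<in> cw_verts e \<and> v \<in> cw_verts e \<and>
        (cw_label e u = i \<and> cw_label e v = j \<or> cw_label e u = j \<and> cw_label e v = i)}"
| "cw_arcs (Relabel i j e) = cw_arcs e"

definition cw_graph :: "'a cw_expr \<Rightarrow> 'a pair_pre_digraph" where
  "cw_graph e = \<lparr> pverts = cw_verts e, parcs = cw_arcs e \<rparr>"

primrec cw_valid :: "'a cw_expr \<Rightarrow> bool" where
  "cw_valid (Create v i) \<longleftrightarrow> True"
| "cw_valid (Disj_Union e f) \<longleftrightarrow> cw_valid e \<and> cw_valid f \<and> cw_verts e \<inter> cw_verts f = {}"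
| "cw_valid (Join i j e) \<longleftrightarrow> i \<noteq> j \<and> cw_valid e"
| "cw_valid (Relabel i j e) \<longleftrightarrow> cw_valid e"

primrec cw_labels :: "'a cw_expr \<Rightarrow> nat set" where
  "cw_labels (Create v i) = {i}"
| "cw_labels (Disj_Union e f) = cw_labels e \<union> cw_labels f"
| "cw_labels (Join i j e) = {i, j} \<union> cw_labels e"
| "cw_labels (Relabel i j e) = {i, j} \<union> cw_labels e"

definition is_create :: "'a cw_expr \<Rightarrow> bool" where
  "is_create e \<longleftrightarrow> (\<exists>v i. e = Create v i)"

primrec cw_linear :: "'a cw_expr \<Rightarrow> bool" where
  "cw_linear (Create v i) \<longleftrightarrow> True"
| "cw_linear (Disj_Union e f) \<longleftrightarrow> cw_linear e \<and> cw_linear f \<and> (is_create e \<or> is_create f)"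
| "cw_linear (Join i j e) \<longleftrightarrow> cw_linear e"
| "cw_linear (Relabel i j e) \<longleftrightarrow> cw_linear e"

definition cwd :: "'a pair_pre_digraph \<Rightarrow> nat" where
  "cwd G = (LEAST k. \<exists>e. cw_valid e \<and> cw_graph e = G \<and> card (cw_labels e) = k)"

definition lcwd :: "'a pair_pre_digraph \<Rightarrow> nat" where
  "lcwd G = (LEAST k. \<exists>e. cw_valid e \<and> cw_linear e \<and> cw_graph e = G \<and> card (cw_labels e) = k)"

section \<open>Minimal hereditary classes of unbounded parameter\<close>

definition bounded_param :: "('a pair_pre_digraph \<Rightarrow> nat) \<Rightarrow> 'a pair_pre_digraph set \<Rightarrow> bool" where
  "bounded_param p X \<longleftrightarrow> (\<exists>c. \<forall>G\<in>X. p G \<le> c)"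

definition minimal_hereditary_unbounded ::
    "(nat pair_pre_digraph \<Rightarrow> nat) \<Rightarrow> nat pair_pre_digraph set \<Rightarrow> bool" where
  "minimal_hereditary_unbounded p X \<longleftrightarrow>
     hereditary X \<and> \<not> bounded_param p X \<and>
     (\<forall>Y. hereditary Y \<and> Y \<subset> X \<longrightarrow> bounded_param p Y)"

section \<open>Binary words and the classes \<open>\<G>\<^sub>\<alpha>\<close>\<close>

text \<open>
  An infinite word is a function on \<^typ>\<open>nat\<close> whose letters are its values at \<open>1, 2, \<dots>\<close>; the value at
  \<open>0\<close> is ignored. The pair \<open>(i, j)\<close> with \<open>i, j \<ge> 1\<close> stands for the vertex \<open>v\<^sub>i\<^sub>,\<^sub>j\<close> in column \<open>j\<close>.
\<close>

definition binary_word :: "(nat \<Rightarrow> nat) \<Rightarrow> bool" where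
  "binary_word \<alpha> \<longleftrightarrow> (\<forall>i\<ge>1. \<alpha> i \<in> {0, 1})"

definition periodic_word :: "(nat \<Rightarrow> 'a) \<Rightarrow> bool" where
  "periodic_word \<alpha> \<longleftrightarrow> (\<exists>p\<ge>1. \<forall>i\<ge>1. \<alpha> i = \<alpha> (i + p))"

definition P_verts :: "(nat \<times> nat) set" where
  "P_verts = {1..} \<times> {1..}"

fun P_step :: "(nat \<Rightarrow> nat) \<Rightarrow> nat \<times> nat \<Rightarrow> nat \<times> nat \<Rightarrow> bool" where
  "P_step \<alpha> (i, j) (k, l) \<longleftrightarrow> l = j + 1 \<and> (\<alpha> j = 0 \<and> i = k \<or> \<alpha> j = 1 \<and> i \<noteq> k)"

definition P_graph :: "(nat \<Rightarrow> nat) \<Rightarrow> (nat \<times> nat) pair_pre_digraph" where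
  "P_graph \<alpha> =
     \<lparr> pverts = P_verts,
       parcs = {(u, v). u \<in> P_verts \<and> v \<in> P_verts \<and> (P_step \<alpha> u v \<or> P_step \<alpha> v u)} \<rparr>"

definition G_class :: "(nat \<Rightarrow> nat) \<Rightarrow> nat pair_pre_digraph set" where
  "G_class \<alpha> = {G. fin_graph G \<and> (\<exists>H. fin_graph H \<and> induced_in H (P_graph \<alpha>) \<and> isomorphic H G)}"

end

theory Submission
  imports Defs "HOL-Library.Product_Lexorder"
begin

text \<open>
  Unboundedness: an expression with \<open>k\<close> labels for a large grid yields a balanced vertex
  partition \<open>(A, B)\<close> in which the vertices of \<open>A\<close> have at most \<open>k\<close> different neighbourhoods in \<open>B\<close>.
  Edges between \<open>A\<close> and \<open>B\<close> in distant pairs of consecutive columns have endpoints in \<open>A\<close> with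
  different neighbourhoods, so only \<open>3k\<close> pairs of consecutive columns contain such edges; within each
  of them at most \<open>2k\<close> rows change sides, and in all other pairs none does. Hence all but \<open>6k\<^sup>2\<close> rows
  lie on one side, and a pair joined by a co-matching without \<open>A\<close>-\<open>B\<close> edges forces it to be the same
  side for all of them, which contradicts the balance.

  Minimality: if a subclass omits a graph contained in \<open>n\<close> rows and \<open>m\<close> columns, cut the columns into
  blocks of \<open>T > m\<close> columns, \<open>T\<close> a multiple of the period. By periodicity, a member of the subclass
  contains fewer than \<open>n + 1\<close> complete rows of each block, and every other row can be cut in each block
  at a missing vertex. Listing the vertices piece by piece from left to right, the neighbourhood of a
  listed vertex among the remaining ones is determined by its column, and by its row as well in a
  bounded number of exceptional rows. Such an order gives an expression of bounded linear clique-width.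
\<close>

section \<open>Graph embeddings\<close>

lemma fin_graph_iff:
  "fin_graph G \<longleftrightarrow> finite (pverts G) \<and> pverts G \<noteq> {} \<and> parcs G \<subseteq> pverts G \<times> pverts G \<and>
     sym (parcs G) \<and> irrefl (parcs G)"
proof
  assume G: "fin_graph G"
  then interpret pair_graph G by (simp add: fin_graph_def)
  have "sym (parcs G)"
    using sym_arcs by (simp add: symmetric_def)
  then show "finite (pverts G) \<and> pverts G \<noteq> {} \<and> parcs G \<subseteq> pverts G \<times> pverts G \<and>
     sym (parcs G) \<and> irrefl (parcs G)"
    using G by (auto simp: fin_graph_def irrefl_def dest: in_arcsD1 in_arcsD2 no_loops')
next
  assume R: "finite (pverts G) \<and> pverts G \<noteq> {} \<and> parcs G \<subseteq> pverts G \<times> pverts G \<and>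
     sym (parcs G) \<and> irrefl (parcs G)"
  then have "finite (parcs G)"
    using finite_subset by blast
  moreover have "symmetric (with_proj G)"
    using R by (simp add: symmetric_def)
  ultimately have "pair_graph G"
    using R by unfold_locales (auto simp: irrefl_def)
  then show "fin_graph G"
    using R by (simp add: fin_graph_def)
qed

lemma fin_graph_imp_pair_wf: "fin_graph G \<Longrightarrow> pair_wf_digraph G"
  by (auto simp: fin_graph_iff pair_wf_digraph_def)

lemma pair_wf_P_graph: "pair_wf_digraph (P_graph \<alpha>)"
  by (auto simp: pair_wf_digraph_def P_graph_def)

lemma induced_in_iff:
  assumes "pair_wf_digraph G"
  shows "induced_in H G \<longleftrightarrow>
    pverts H \<subseteq> pverts G \<and> parcs H = parcs G \<inter> (pverts H \<times> pverts H)"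
proof
  assume "induced_in H G"
  then show "pverts H \<subseteq> pverts G \<and> parcs H = parcs G \<inter> (pverts H \<times> pverts H)"
    unfolding induced_in_def induced_subgraph_def subgraph_def by (auto simp: with_proj_def)
next
  assume R: "pverts H \<subseteq> pverts G \<and> parcs H = parcs G \<inter> (pverts H \<times> pverts H)"
  then have "pair_wf_digraph H"
    by (auto simp: pair_wf_digraph_def)
  then show "induced_in H G"
    using R assms unfolding induced_in_def induced_subgraph_def subgraph_def compatible_def
    by (auto simp: wf_digraph_wp_iff)
qed

definition image_graph :: "('a \<Rightarrow> 'b) \<Rightarrow> 'a pair_pre_digraph \<Rightarrow> 'b pair_pre_digraph" where
  "image_graph f G = \<lparr> pverts = f ` pverts G, parcs = map_prod f f ` parcs G \<rparr>"

text \<open>The equivalence on arcs, rather than an implication, makes the image an induced copy;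
  one such map replaces an isomorphism followed by an inclusion.\<close>

definition embedding :: "('a \<Rightarrow> 'b) \<Rightarrow> 'a pair_pre_digraph \<Rightarrow> 'b pair_pre_digraph \<Rightarrow> bool" where
  "embedding f G H \<longleftrightarrow> inj_on f (pverts G) \<and> f ` pverts G \<subseteq> pverts H \<and>
     (\<forall>u\<in>pverts G. \<forall>v\<in>pverts G. (u, v) \<in> parcs G \<longleftrightarrow> (f u, f v) \<in> parcs H)"

text \<open>An isomorphism in the library has separate maps for vertices, arcs, heads and tails.
  When arcs are pairs, the vertex map forces the other three.\<close>

lemma isomorphic_iff:
  assumes "pair_wf_digraph G"
  shows "isomorphic G H \<longleftrightarrow> (\<exists>f. inj_on f (pverts G) \<and> H = image_graph f G)"
proof
  assume "isomorphic G H"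
  then obtain h where h: "pre_digraph.digraph_isomorphism (with_proj G) h"
    and H: "with_proj H = app_iso h (with_proj G)"
    unfolding isomorphic_def digraph_iso_def by blast
  let ?f = "iso_verts h"
  have eq: "pverts H = ?f ` pverts G" "parcs H = iso_arcs h ` parcs G"
    "iso_tail h = fst" "iso_head h = snd"
    using H by (simp_all add: with_proj_def app_iso_def)
  have "iso_arcs h a = map_prod ?f ?f a" if "a \<in> parcs G" for a
    using h that eq unfolding pre_digraph.digraph_isomorphism_def
    by (auto simp: prod_eq_iff)
  then have "parcs H = map_prod ?f ?f ` parcs G"
    using eq by (auto simp: image_def)
  moreover have "inj_on ?f (pverts G)"
    using h unfolding pre_digraph.digraph_isomorphism_def by simp
  ultimately show "\<exists>f. inj_on f (pverts G) \<and> H = image_graph f G"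
    using eq by (intro exI[of _ ?f]) (simp add: image_graph_def)
next
  assume "\<exists>f. inj_on f (pverts G) \<and> H = image_graph f G"
  then obtain f where f: "inj_on f (pverts G)" "H = image_graph f G"
    by blast
  let ?h = "\<lparr> iso_verts = f, iso_arcs = map_prod f f, iso_head = snd, iso_tail = fst \<rparr>"
  have "parcs G \<subseteq> pverts G \<times> pverts G"
    using assms by (auto simp: pair_wf_digraph_def)
  then have "inj_on (map_prod f f) (parcs G)"
    using map_prod_inj_on[OF f(1) f(1)] inj_on_subset by blast
  then have "pre_digraph.digraph_isomorphism (with_proj G) ?h"
    using f assms unfolding pre_digraph.digraph_isomorphism_def
    by (auto simp: wf_digraph_wp_iff)
  moreover have "with_proj H = app_iso ?h (with_proj G)"
    using f by (simp add: with_proj_def app_iso_def image_graph_def)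
  ultimately show "isomorphic G H"
    unfolding isomorphic_def digraph_iso_def by blast
qed

section \<open>Composing embeddings and transporting graphs along injections\<close>

lemma embedding_trans:
  assumes "embedding f G H" and "embedding g H K"
  shows "embedding (g \<circ> f) G K"
proof -
  have "inj_on (g \<circ> f) (pverts G)"
    using assms unfolding embedding_def by (meson comp_inj_on inj_on_subset)
  then show ?thesis
    using assms by (simp add: embedding_def image_subset_iff)
qed

lemma induced_in_imp_embedding:
  assumes "pair_wf_digraph G" and "induced_in H G"
  shows "embedding id H G"
  using assms by (auto simp: induced_in_iff embedding_def)

lemma fin_graph_image_graph:
  assumes "fin_graph G" and "inj_on f (pverts G)"
  shows "fin_graph (image_graph f G)"
proof -
  have "(u, u) \<notin> map_prod f f ` parcs G" for u
  proof
    assume "(u, u) \<in> map_prod f f ` parcs G"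
    then obtain a b where "(a, b) \<in> parcs G" "f a = u" "f b = u"
      by auto
    then show False
      using assms by (auto simp: fin_graph_iff irrefl_def dest: inj_onD)
  qed
  moreover have "sym (map_prod f f ` parcs G)"
    using assms by (auto simp: fin_graph_iff sym_def)
  ultimately show ?thesis
    using assms by (auto simp: fin_graph_iff image_graph_def irrefl_def)
qed

lemma embedding_image_graph:
  assumes "fin_graph G" and "inj_on f (pverts G)"
  shows "embedding f G (image_graph f G)"
proof -
  have "(u, v) \<in> parcs G" if uv: "u \<in> pverts G" "v \<in> pverts G"
    "(f u, f v) \<in> map_prod f f ` parcs G" for u v
  proof -
    obtain a b where "(a, b) \<in> parcs G" "f a = f u" "f b = f v"
      using uv by auto
    moreover from this have "a = u" "b = v"
      using uv assms by (auto simp: fin_graph_iff dest: inj_onD)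
    ultimately show ?thesis by simp
  qed
  then have "(f u, f v) \<in> map_prod f f ` parcs G \<longleftrightarrow> (u, v) \<in> parcs G"
    if "u \<in> pverts G" "v \<in> pverts G" for u v
    using that by (metis image_eqI map_prod_simp)
  then show ?thesis
    using assms by (simp add: image_graph_def embedding_def)
qed

lemma image_graph_the_inv_into:
  assumes "fin_graph G" and "inj_on f (pverts G)"
  shows "image_graph (the_inv_into (pverts G) f) (image_graph f G) = G"
proof -
  have "map_prod (the_inv_into (pverts G) f) (the_inv_into (pverts G) f) (map_prod f f a) = a"
    if "a \<in> parcs G" for a
    using that assms by (cases a) (auto simp: fin_graph_iff the_inv_into_f_f)
  moreover have "the_inv_into (pverts G) f (f v) = v" if "v \<in> pverts G" for v
    using that assms by (auto simp: the_inv_into_f_f)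
  ultimately show ?thesis
    by (simp add: image_graph_def image_image)
qed

lemma isomorphic_image_graph:
  assumes "fin_graph G" and "inj_on f (pverts G)"
  shows "isomorphic G (image_graph f G)" and "isomorphic (image_graph f G) G"
proof -
  show "isomorphic G (image_graph f G)"
    using assms by (auto simp: isomorphic_iff fin_graph_imp_pair_wf)
  have "inj_on (the_inv_into (pverts G) f) (pverts (image_graph f G))"
    using assms by (simp add: image_graph_def inj_on_the_inv_into)
  then show "isomorphic (image_graph f G) G"
    using image_graph_the_inv_into[OF assms, symmetric]
      isomorphic_iff[OF fin_graph_imp_pair_wf[OF fin_graph_image_graph[OF assms]]] by blast
qed

text \<open>Inverts the isomorphism: the embedding runs from \<open>H\<close> back to
  \<open>G\<close>, so that it can be composed with an embedding of \<open>G\<close> into a larger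
  graph.\<close>

lemma isomorphic_imp_embedding:
  assumes "fin_graph G" and "isomorphic G H"
  shows "\<exists>f. embedding f H G"
proof -
  obtain f where f: "inj_on f (pverts G)" "H = image_graph f G"
    using assms by (auto simp: isomorphic_iff fin_graph_imp_pair_wf)
  have "inj_on (the_inv_into (pverts G) f) (pverts H)"
    using f by (simp add: image_graph_def inj_on_the_inv_into)
  then have "embedding (the_inv_into (pverts G) f) H G"
    using embedding_image_graph[of H "the_inv_into (pverts G) f"]
      image_graph_the_inv_into[OF assms(1) f(1)] fin_graph_image_graph[OF assms(1) f(1)] f(2)
    by simp
  then show "\<exists>f. embedding f H G"
    by blast
qed

lemma induced_in_image_graph:
  assumes "fin_graph G" and "pair_wf_digraph H" and "embedding f G H"
  shows "induced_in (image_graph f G) H"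
proof -
  have "map_prod f f ` parcs G = parcs H \<inter> (f ` pverts G \<times> f ` pverts G)"
  proof (intro equalityI subrelI)
    fix u v assume "(u, v) \<in> map_prod f f ` parcs G"
    then obtain a b where "(a, b) \<in> parcs G" "u = f a" "v = f b"
      by auto
    then show "(u, v) \<in> parcs H \<inter> (f ` pverts G \<times> f ` pverts G)"
      using assms by (auto simp: fin_graph_iff embedding_def)
  next
    fix u v assume "(u, v) \<in> parcs H \<inter> (f ` pverts G \<times> f ` pverts G)"
    then obtain a b where "(f a, f b) \<in> parcs H" "u = f a" "v = f b" "a \<in> pverts G" "b \<in> pverts G"
      by auto
    then show "(u, v) \<in> map_prod f f ` parcs G"
      using assms by (force simp: embedding_def)
  qed
  then show ?thesis
    using assms by (simp add: induced_in_iff image_graph_def embedding_def)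
qed

text \<open>Reduces membership to the existence of a single embedding, the form in which the class
  is used from here on.\<close>

lemma G_class_iff:
  "G \<in> G_class \<alpha> \<longleftrightarrow> fin_graph G \<and> (\<exists>f. embedding f G (P_graph \<alpha>))"
proof
  assume "G \<in> G_class \<alpha>"
  then obtain H where H: "fin_graph G" "fin_graph H" "induced_in H (P_graph \<alpha>)" "isomorphic H G"
    by (auto simp: G_class_def)
  obtain f where "embedding f G H"
    using isomorphic_imp_embedding[OF H(2,4)] by blast
  from embedding_trans[OF this induced_in_imp_embedding[OF pair_wf_P_graph H(3)]]
  show "fin_graph G \<and> (\<exists>f. embedding f G (P_graph \<alpha>))"
    using H(1) by blast
next
  assume "fin_graph G \<and> (\<exists>f. embedding f G (P_graph \<alpha>))"
  then obtain f where f: "fin_graph G" "embedding f G (P_graph \<alpha>)"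
    by blast
  then have "inj_on f (pverts G)"
    by (simp add: embedding_def)
  then show "G \<in> G_class \<alpha>"
    using f isomorphic_image_graph(2)[of G f] induced_in_image_graph[OF _ pair_wf_P_graph, of G f]
      fin_graph_image_graph[of G f]
    unfolding G_class_def by auto
qed

text \<open>The image of \<open>G\<close> is an induced subgraph of \<open>H\<close>, hence in
  \<open>Y\<close>, and \<open>G\<close> is isomorphic to it.\<close>

lemma hereditary_embedding:
  assumes "hereditary Y" and "H \<in> Y" and "fin_graph G" and "embedding f G H"
  shows "G \<in> Y"
proof -
  have H: "fin_graph H"
    using assms(1,2) unfolding hereditary_def graph_class_def by blast
  have f: "inj_on f (pverts G)"
    using assms by (simp add: embedding_def)
  have "image_graph f G \<in> Y"
    using assms(1,2) fin_graph_image_graph[OF assms(3) f]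
      induced_in_image_graph[OF assms(3) fin_graph_imp_pair_wf[OF H] assms(4)]
    unfolding hereditary_def by blast
  then show ?thesis
    using assms(1,3) isomorphic_image_graph(2)[OF assms(3) f]
    unfolding hereditary_def graph_class_def by blast
qed

lemma hereditary_G_class: "hereditary (G_class \<alpha>)"
proof -
  have "H \<in> G_class \<alpha>"
    if GH: "G \<in> G_class \<alpha>" "fin_graph H" "isomorphic G H \<or> induced_in H G" for G H
  proof -
    have G: "fin_graph G"
      using GH by (simp add: G_class_iff)
    obtain f where f: "embedding f H G"
      using GH isomorphic_imp_embedding[OF G]
        induced_in_imp_embedding[OF fin_graph_imp_pair_wf[OF G]] by blast
    obtain g where "embedding g G (P_graph \<alpha>)"
      using GH by (auto simp: G_class_iff)
    then show ?thesis
      using GH(2) embedding_trans[OF f] by (auto simp: G_class_iff)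
  qed
  then show ?thesis
    by (auto simp: hereditary_def graph_class_def G_class_iff)
qed

section \<open>Expressions from vertex orders and balanced cuts\<close>

lemma cw_arcs_subset: "cw_arcs e \<subseteq> cw_verts e \<times> cw_verts e"
  by (induction e) auto

lemma finite_cw_verts [simp]: "finite (cw_verts e)"
  by (induction e) auto

lemma finite_cw_labels [simp]: "finite (cw_labels e)"
  by (induction e) auto

lemma cw_label_in_labels: "u \<in> cw_verts e \<Longrightarrow> cw_label e u \<in> cw_labels e"
  by (induction e) auto

text \<open>Descend to the larger operand of each union until at most \<open>2 * m\<close> vertices
  remain; a union with more than \<open>2 * m\<close> vertices has an operand with more than
  \<open>m\<close>. The map \<open>l\<close> is the labelling at the subexpression reached: vertices
  sharing a label there are treated alike by all later operations. Agreement of the final labels is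
  carried along so that the induction passes through joins and relabellings.\<close>

lemma cw_balanced_cut:
  assumes "cw_valid e" and "1 \<le> m" and "m < card (cw_verts e)"
  shows "\<exists>A l. A \<subseteq> cw_verts e \<and> m < card A \<and> card A \<le> 2 * m \<and> l ` A \<subseteq> cw_labels e \<and>
    (\<forall>u\<in>A. \<forall>v\<in>A. l u = l v \<longrightarrow> cw_label e u = cw_label e v \<and>
      (\<forall>w\<in>cw_verts e - A. (u, w) \<in> cw_arcs e \<longleftrightarrow> (v, w) \<in> cw_arcs e))"
    (is "\<exists>A l. ?P e A l")
  using assms
proof (induction e)
  case (Create v i)
  then show ?case by simp
next
  case (Disj_Union e f)
  show ?case
  proof (cases "card (cw_verts (Disj_Union e f)) \<le> 2 * m")
    case True
    then show ?thesis
      using Disj_Union.prems cw_label_in_labels[of _ "Disj_Union e f"]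
      by (intro exI[of _ "cw_verts (Disj_Union e f)"] exI[of _ "cw_label (Disj_Union e f)"]) blast
  next
    case False
    have disj: "cw_verts e \<inter> cw_verts f = {}"
      using Disj_Union.prems by simp
    then have "2 * m < card (cw_verts e) + card (cw_verts f)"
      using False by (simp add: card_Un_disjoint)
    then consider "m < card (cw_verts e)" | "m < card (cw_verts f)"
      by linarith
    then show ?thesis
    proof cases
      case 1
      then obtain A l where A: "?P e A l"
        using Disj_Union by auto
      have sub: "A \<subseteq> cw_verts e" and
        eq: "\<And>u v w. u \<in> A \<Longrightarrow> v \<in> A \<Longrightarrow> l u = l v \<Longrightarrow> cw_label e u = cw_label e v"
          "\<And>u v w. u \<in> A \<Longrightarrow> v \<in> A \<Longrightarrow> l u = l v \<Longrightarrow> w \<in> cw_verts e - A \<Longrightarrow>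
            (u, w) \<in> cw_arcs e \<longleftrightarrow> (v, w) \<in> cw_arcs e"
        using A by blast+
      have lab: "cw_label (Disj_Union e f) u = cw_label e u" if "u \<in> A" for u
        using that sub disj by auto
      have arc: "(u, w) \<in> cw_arcs (Disj_Union e f) \<longleftrightarrow> (u, w) \<in> cw_arcs e" if "u \<in> A" for u w
        using that sub disj cw_arcs_subset[of f] by auto
      \<comment> \<open>For \<open>w\<close> outside \<open>cw_verts e\<close> both sides are false,
        so the equivalence extends to every \<open>w\<close> outside \<open>A\<close>.\<close>
      have "(u, w) \<in> cw_arcs e \<longleftrightarrow> (v, w) \<in> cw_arcs e"
        if "u \<in> A" "v \<in> A" "l u = l v" "w \<notin> A" for u v w
        using eq(2)[OF that(1-3), of w] that(4) cw_arcs_subset[of e] by blast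
      then have adj: "(u, w) \<in> cw_arcs (Disj_Union e f) \<longleftrightarrow> (v, w) \<in> cw_arcs (Disj_Union e f)"
        if "u \<in> A" "v \<in> A" "l u = l v" "w \<notin> A" for u v w
        unfolding arc[OF that(1)] arc[OF that(2)] using that .
      have "m < card A" "card A \<le> 2 * m" "l ` A \<subseteq> cw_labels (Disj_Union e f)"
        "A \<subseteq> cw_verts (Disj_Union e f)"
        using A by (simp_all add: le_supI1 le_supI2)
      moreover have "cw_label (Disj_Union e f) u = cw_label (Disj_Union e f) v"
        if "u \<in> A" "v \<in> A" "l u = l v" for u v
        unfolding lab[OF that(1)] lab[OF that(2)] using that by (rule eq(1))
      ultimately have "?P (Disj_Union e f) A l"
        using adj by blast
      then show ?thesis by blast
    next
      case 2
      then obtain A l where A: "?P f A l"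
        using Disj_Union by auto
      have sub: "A \<subseteq> cw_verts f" and
        eq: "\<And>u v w. u \<in> A \<Longrightarrow> v \<in> A \<Longrightarrow> l u = l v \<Longrightarrow> cw_label f u = cw_label f v"
          "\<And>u v w. u \<in> A \<Longrightarrow> v \<in> A \<Longrightarrow> l u = l v \<Longrightarrow> w \<in> cw_verts f - A \<Longrightarrow>
            (u, w) \<in> cw_arcs f \<longleftrightarrow> (v, w) \<in> cw_arcs f"
        using A by blast+
      have lab: "cw_label (Disj_Union e f) u = cw_label f u" if "u \<in> A" for u
        using that sub disj by auto
      have arc: "(u, w) \<in> cw_arcs (Disj_Union e f) \<longleftrightarrow> (u, w) \<in> cw_arcs f" if "u \<in> A" for u w
        using that sub disj cw_arcs_subset[of e] by auto
      have "(u, w) \<in> cw_arcs f \<longleftrightarrow> (v, w) \<in> cw_arcs f"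
        if "u \<in> A" "v \<in> A" "l u = l v" "w \<notin> A" for u v w
        using eq(2)[OF that(1-3), of w] that(4) cw_arcs_subset[of f] by blast
      then have adj: "(u, w) \<in> cw_arcs (Disj_Union e f) \<longleftrightarrow> (v, w) \<in> cw_arcs (Disj_Union e f)"
        if "u \<in> A" "v \<in> A" "l u = l v" "w \<notin> A" for u v w
        unfolding arc[OF that(1)] arc[OF that(2)] using that .
      have "m < card A" "card A \<le> 2 * m" "l ` A \<subseteq> cw_labels (Disj_Union e f)"
        "A \<subseteq> cw_verts (Disj_Union e f)"
        using A by (simp_all add: le_supI1 le_supI2)
      moreover have "cw_label (Disj_Union e f) u = cw_label (Disj_Union e f) v"
        if "u \<in> A" "v \<in> A" "l u = l v" for u v
        unfolding lab[OF that(1)] lab[OF that(2)] using that by (rule eq(1))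
      ultimately have "?P (Disj_Union e f) A l"
        using adj by blast
      then show ?thesis by blast
    qed
  qed
next
  case (Join i j e)
  then obtain A l where A: "?P e A l"
    by auto
  have "cw_label (Join i j e) u = cw_label (Join i j e) v \<and>
      (\<forall>w\<in>cw_verts (Join i j e) - A. (u, w) \<in> cw_arcs (Join i j e) \<longleftrightarrow> (v, w) \<in> cw_arcs (Join i j e))"
    if uv: "u \<in> A" "v \<in> A" "l u = l v" for u v
  proof -
    have "cw_label e u = cw_label e v" "\<forall>w\<in>cw_verts e - A. (u, w) \<in> cw_arcs e \<longleftrightarrow> (v, w) \<in> cw_arcs e"
      "u \<in> cw_verts e" "v \<in> cw_verts e"
      using A uv by blast+
    then show ?thesis
      by simp
  qed
  moreover have "A \<subseteq> cw_verts (Join i j e)" "m < card A" "card A \<le> 2 * m" "l ` A \<subseteq> cw_labels (Join i j e)"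
    using A by (simp_all add: le_supI2 subset_insertI2)
  ultimately show ?case
    by blast
next
  case (Relabel i j e)
  then obtain A l where A: "?P e A l"
    by auto
  have "cw_label (Relabel i j e) u = cw_label (Relabel i j e) v \<and>
      (\<forall>w\<in>cw_verts (Relabel i j e) - A. (u, w) \<in> cw_arcs (Relabel i j e) \<longleftrightarrow> (v, w) \<in> cw_arcs (Relabel i j e))"
    if uv: "u \<in> A" "v \<in> A" "l u = l v" for u v
  proof -
    have "cw_label e u = cw_label e v" "\<forall>w\<in>cw_verts e - A. (u, w) \<in> cw_arcs e \<longleftrightarrow> (v, w) \<in> cw_arcs e"
      "u \<in> cw_verts e" "v \<in> cw_verts e"
      using A uv by blast+
    then show ?thesis
      by simp
  qed
  moreover have "A \<subseteq> cw_verts (Relabel i j e)" "m < card A" "card A \<le> 2 * m" "l ` A \<subseteq> cw_labels (Relabel i j e)"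
    using A by (simp_all add: le_supI2 subset_insertI2)
  ultimately show ?case
    by blast
qed

section \<open>Linear expressions from vertex orders\<close>

lemma card_image_le_card_image:
  assumes "finite S" and "\<And>u v. u \<in> S \<Longrightarrow> v \<in> S \<Longrightarrow> q u = q v \<Longrightarrow> l u = l v"
  shows "card (l ` S) \<le> card (q ` S)"
proof -
  have "l ` S \<subseteq> (l \<circ> inv_into S q) ` (q ` S)"
  proof
    fix y assume "y \<in> l ` S"
    then obtain u where u: "u \<in> S" "y = l u" by blast
    then have "l (inv_into S q (q u)) = l u"
      by (intro assms(2)) (auto intro: inv_into_into f_inv_into_f)
    then show "y \<in> (l \<circ> inv_into S q) ` (q ` S)"
      using u by (metis comp_apply image_eqI)
  qed
  then show ?thesis
    using assms(1) by (meson finite_imageI surj_card_le)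
qed

text \<open>As long as two labels in use stand for the same value of \<open>q\<close>, one is
  renamed to the other, which lowers the number of labels in use. Both already occur in the
  expression, so \<open>cw_labels\<close> does not grow.\<close>

lemma cw_merge_labels:
  assumes "cw_valid e" and "cw_linear e"
    and "\<And>u v. u \<in> cw_verts e \<Longrightarrow> v \<in> cw_verts e \<Longrightarrow> cw_label e u = cw_label e v \<Longrightarrow> q u = q v"
  shows "\<exists>e'. cw_valid e' \<and> cw_linear e' \<and> cw_verts e' = cw_verts e \<and> cw_arcs e' = cw_arcs e \<and>
    cw_labels e' = cw_labels e \<and>
    (\<forall>u\<in>cw_verts e. \<forall>v\<in>cw_verts e. cw_label e' u = cw_label e' v \<longleftrightarrow> q u = q v)"
  using assms
proof (induction "card (cw_label e ` cw_verts e)" arbitrary: e rule: less_induct)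
  case less
  show ?case
  proof (cases "\<forall>u\<in>cw_verts e. \<forall>v\<in>cw_verts e. q u = q v \<longrightarrow> cw_label e u = cw_label e v")
    case True
    then show ?thesis
      using less.prems by (intro exI[of _ e]) blast
  next
    case False
    then obtain u v where uv: "u \<in> cw_verts e" "v \<in> cw_verts e" "q u = q v"
      "cw_label e u \<noteq> cw_label e v" by blast
    let ?i = "cw_label e u" and ?j = "cw_label e v"
    let ?e = "Relabel ?i ?j e"
    have "cw_label ?e ` cw_verts ?e \<subseteq> cw_label e ` cw_verts e - {?i}"
      using uv by auto
    moreover have "?i \<in> cw_label e ` cw_verts e"
      using uv by simp
    ultimately have "cw_label ?e ` cw_verts ?e \<subset> cw_label e ` cw_verts e"
      by blast
    then have lt: "card (cw_label ?e ` cw_verts ?e) < card (cw_label e ` cw_verts e)"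
      by (intro psubset_card_mono) auto
    \<comment> \<open>The merged label carries two old label classes on which \<open>q\<close> takes
      the common value \<open>q u = q v\<close>, so labels still determine \<open>q\<close>.\<close>
    have q: "q x = q y" if "x \<in> cw_verts ?e" "y \<in> cw_verts ?e" "cw_label ?e x = cw_label ?e y" for x y
      using that uv less.prems(3)[of x y] less.prems(3)[of u x] less.prems(3)[of u y]
        less.prems(3)[of v x] less.prems(3)[of v y]
      by (auto split: if_splits)
    have labels: "cw_labels ?e = cw_labels e"
      using uv cw_label_in_labels by auto
    have "cw_valid ?e" "cw_linear ?e"
      using less.prems by simp_all
    from less.hyps[OF lt this q] show ?thesis
      unfolding labels by (simp only: cw_verts.simps cw_arcs.simps)
  qed
qed

text \<open>One \<open>Join\<close> for each element of \<open>I\<close>;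
  \<open>i \<notin> I\<close> makes each of them valid. Joins leave the labelling unchanged, so they
  do not interfere with one another.\<close>

lemma cw_join_labels:
  assumes "finite I" and "i \<notin> I" and "cw_valid e" and "cw_linear e"
  shows "\<exists>e'. cw_valid e' \<and> cw_linear e' \<and> cw_verts e' = cw_verts e \<and> cw_label e' = cw_label e \<and>
    cw_labels e' \<subseteq> insert i I \<union> cw_labels e \<and>
    cw_arcs e' = cw_arcs e \<union> {(u, v). u \<in> cw_verts e \<and> v \<in> cw_verts e \<and>
      (cw_label e u = i \<and> cw_label e v \<in> I \<or> cw_label e u \<in> I \<and> cw_label e v = i)}"
  using assms(1,2)
proof (induction I)
  case empty
  then show ?case
    using assms by (intro exI[of _ e]) auto
next
  case (insert j I)
  then obtain e' where "cw_valid e' \<and> cw_linear e' \<and> cw_verts e' = cw_verts e \<and> cw_label e' = cw_label e \<and>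
    cw_labels e' \<subseteq> insert i I \<union> cw_labels e \<and>
    cw_arcs e' = cw_arcs e \<union> {(u, v). u \<in> cw_verts e \<and> v \<in> cw_verts e \<and>
      (cw_label e u = i \<and> cw_label e v \<in> I \<or> cw_label e u \<in> I \<and> cw_label e v = i)}"
    by auto
  then show ?case
    using insert.prems by (intro exI[of _ "Join i j e'"]) auto
qed

text \<open>
  One vertex is added at a time. The invariant is that two vertices carry the same label iff they have
  the same neighbours among the vertices still to come; so one spare label suffices for the new vertex.
\<close>

lemma cw_linear_expr_of_order:
  fixes \<kappa> :: "'a \<Rightarrow> 'b::linorder"
  assumes G: "fin_graph G" and \<kappa>: "inj_on \<kappa> (pverts G)"
    and k: "\<And>S. S \<subseteq> pverts G \<Longrightarrow> S \<noteq> {} \<Longrightarrow> (\<And>u w. u \<in> S \<Longrightarrow> w \<in> pverts G - S \<Longrightarrow> \<kappa> u < \<kappa> w) \<Longrightarrow>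
      card ((\<lambda>u. {w \<in> pverts G - S. (u, w) \<in> parcs G}) ` S) \<le> k"
  shows "\<exists>e. cw_valid e \<and> cw_linear e \<and> cw_graph e = G \<and> cw_labels e \<subseteq> {..k}"
proof -
  let ?V = "pverts G" and ?N = "\<lambda>S u. {w \<in> pverts G - S. (u, w) \<in> parcs G}"
  have irr: "(u, u) \<notin> parcs G" and sym: "(u, v) \<in> parcs G \<longleftrightarrow> (v, u) \<in> parcs G" for u v
    using G by (auto simp: fin_graph_iff irrefl_def dest: symD)
  have build: "\<exists>e. cw_valid e \<and> cw_linear e \<and> cw_verts e = S \<and> cw_arcs e = parcs G \<inter> (S \<times> S) \<and>
      cw_labels e \<subseteq> {..k} \<and>
      (\<forall>u\<in>S. \<forall>v\<in>S. cw_label e u = cw_label e v \<longleftrightarrow> ?N S u = ?N S v)"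
    if "finite S" "S \<subseteq> ?V" "S \<noteq> {}" "\<forall>u\<in>S. \<forall>w\<in>?V - S. \<kappa> u < \<kappa> w" for S
    using that
  proof (induction S rule: finite_ranking_induct[where f = \<kappa>])
    case empty
    then show ?case by simp
  next
    case (insert x S)
    show ?case
    proof (cases "x \<in> S \<or> S = {}")
      case True
      show ?thesis
      proof (cases "x \<in> S")
        case True
        then show ?thesis
          using insert.IH insert.prems by (auto simp: insert_absorb)
      next
        case False
        then show ?thesis
          using True irr by (intro exI[of _ "Create x 0"]) auto
      qed
    next
      case False
      then have x: "x \<notin> S" "S \<noteq> {}" "x \<in> ?V" "S \<subseteq> ?V"
        using insert.prems by auto
      \<comment> \<open>The ranking induction adds \<open>x\<close> with the largest key so far, so
        \<open>S\<close> without \<open>x\<close> is again an initial segment and the induction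
        hypothesis applies to it.\<close>
      have init: "\<kappa> u < \<kappa> w" if uw: "u \<in> S" "w \<in> ?V - S" for u w
      proof (cases "w = x")
        case True
        then have "\<kappa> u \<le> \<kappa> x" "\<kappa> u \<noteq> \<kappa> x"
          using insert.hyps(2) uw x \<kappa> by (auto simp: inj_on_eq_iff subset_iff)
        then show ?thesis
          using True by simp
      next
        case False
        then show ?thesis
          using insert.prems uw by auto
      qed
      obtain e where E: "cw_valid e \<and> cw_linear e \<and> cw_verts e = S \<and>
        cw_arcs e = parcs G \<inter> (S \<times> S) \<and> cw_labels e \<subseteq> {..k} \<and>
        (\<forall>u\<in>S. \<forall>v\<in>S. cw_label e u = cw_label e v \<longleftrightarrow> ?N S u = ?N S v)"
        using insert.IH[OF x(4,2)] init by blast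
      then have e: "cw_valid e" "cw_linear e" "cw_verts e = S" "cw_arcs e = parcs G \<inter> (S \<times> S)"
        "cw_labels e \<subseteq> {..k}"
        by blast+
      have lab: "cw_label e u = cw_label e v \<longleftrightarrow> ?N S u = ?N S v" if "u \<in> S" "v \<in> S" for u v
        using E that by blast
      have finS: "finite S"
        using e(3) finite_cw_verts by metis
      have "card (cw_label e ` S) \<le> card (?N S ` S)"
        by (intro card_image_le_card_image finS) (use lab in blast)
      also have "\<dots> \<le> k"
        using k[of S] x init by blast
      finally have "card (cw_label e ` S) < card {..k}"
        by simp
      then have "\<not> {..k} \<subseteq> cw_label e ` S"
        using finS card_mono by (metis finite_imageI leD)
      then obtain i where i: "i \<le> k" "i \<notin> cw_label e ` S"
        by auto
      define I where "I = cw_label e ` {u \<in> S. (x, u) \<in> parcs G}"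
      \<comment> \<open>As \<open>x\<close> is still to come, vertices with equal labels agree on
        adjacency to \<open>x\<close>. Joining the label of \<open>x\<close> to the labels in
        \<open>I\<close> therefore adds exactly the edges at \<open>x\<close>.\<close>
      have I: "cw_label e u \<in> I \<longleftrightarrow> (x, u) \<in> parcs G" if u: "u \<in> S" for u
      proof
        assume "cw_label e u \<in> I"
        then obtain v where v: "v \<in> S" "(x, v) \<in> parcs G" "cw_label e u = cw_label e v"
          by (auto simp: I_def)
        then have "?N S u = ?N S v"
          using lab u by blast
        moreover have "x \<in> ?N S v"
          using v x sym by auto
        ultimately have "(u, x) \<in> parcs G"
          by blast
        then show "(x, u) \<in> parcs G"
          using sym by blast
      qed (use u in \<open>auto simp: I_def\<close>)
      have finI: "finite I" and iI: "i \<notin> I" and Ik: "I \<subseteq> {..k}"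
        using finS i e cw_label_in_labels[of _ e] by (auto simp: I_def)
      define e1 where "e1 = Disj_Union (Create x i) e"
      have e1: "cw_valid e1" "cw_linear e1" "cw_verts e1 = insert x S"
        "cw_arcs e1 = parcs G \<inter> (S \<times> S)" "cw_labels e1 \<subseteq> {..k}"
        "cw_label e1 x = i" "\<And>u. u \<in> S \<Longrightarrow> cw_label e1 u = cw_label e u"
        using e x i by (auto simp: e1_def is_create_def)
      obtain e2 where E2: "cw_valid e2" "cw_linear e2" "cw_verts e2 = cw_verts e1"
        "cw_label e2 = cw_label e1" "cw_labels e2 \<subseteq> insert i I \<union> cw_labels e1" and
        arcs: "cw_arcs e2 = cw_arcs e1 \<union> {(u, v). u \<in> cw_verts e1 \<and> v \<in> cw_verts e1 \<and>
          (cw_label e1 u = i \<and> cw_label e1 v \<in> I \<or> cw_label e1 u \<in> I \<and> cw_label e1 v = i)}"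
        using cw_join_labels[OF finI iI e1(1,2)] by blast
      have e2: "cw_valid e2" "cw_linear e2" "cw_verts e2 = insert x S"
        "cw_label e2 = cw_label e1" "cw_labels e2 \<subseteq> {..k}"
        using E2 e1(3,5) i(1) Ik by auto
      have l1: "cw_label e1 u = i \<longleftrightarrow> u = x" if "u \<in> insert x S" for u
        using that e1(6,7) i(2) by (metis image_eqI insert_iff)
      have l2: "cw_label e1 u \<in> I \<longleftrightarrow> u \<in> S \<and> (x, u) \<in> parcs G" if "u \<in> insert x S" for u
        using that e1 iI I x by auto
      have arcs2: "cw_arcs e2 = parcs G \<inter> (insert x S \<times> insert x S)"
      proof (intro set_eqI, clarify)
        fix u v
        show "(u, v) \<in> cw_arcs e2 \<longleftrightarrow> (u, v) \<in> parcs G \<inter> (insert x S \<times> insert x S)"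
        proof (cases "u \<in> insert x S \<and> v \<in> insert x S")
          case True
          have "(u, v) \<in> cw_arcs e2 \<longleftrightarrow> (u, v) \<in> parcs G \<and> u \<in> S \<and> v \<in> S \<or>
            u = x \<and> v \<in> S \<and> (x, v) \<in> parcs G \<or> u \<in> S \<and> (x, u) \<in> parcs G \<and> v = x"
            unfolding arcs e1(3,4) using True l1[of u] l1[of v] l2[of u] l2[of v] by blast
          then show ?thesis
            using True irr[of x] sym[of u v] by blast
        next
          case False
          then show ?thesis
            using cw_arcs_subset[of e2] e2(3) by blast
        qed
      qed
      \<comment> \<open>Once \<open>x\<close> is listed it drops out of all remaining
        neighbourhoods. Equal labels still imply equal neighbourhoods; merging labels restores the
        converse.\<close>
      have "?N (insert x S) u = ?N (insert x S) v"
        if uv: "u \<in> cw_verts e2" "v \<in> cw_verts e2" "cw_label e2 u = cw_label e2 v" for u v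
      proof (cases "u = x \<or> v = x")
        case True
        then show ?thesis
          using uv l1 e1 e2 by metis
      next
        case False
        then have "?N S u = ?N S v"
          using uv lab e1 e2 by auto
        moreover have "?N (insert x S) w = ?N S w - {x}" for w
          by auto
        ultimately show ?thesis
          by simp
      qed
      from cw_merge_labels[where q = "?N (insert x S)", OF e2(1,2) this] obtain e3 where
        "cw_valid e3 \<and> cw_linear e3 \<and> cw_verts e3 = cw_verts e2 \<and> cw_arcs e3 = cw_arcs e2 \<and>
          cw_labels e3 = cw_labels e2 \<and> (\<forall>u\<in>cw_verts e2. \<forall>v\<in>cw_verts e2.
            cw_label e3 u = cw_label e3 v \<longleftrightarrow> ?N (insert x S) u = ?N (insert x S) v)"
        by blast
      then show ?thesis
        unfolding e2(3) arcs2 using e2(5) by (intro exI[of _ e3]) simp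
    qed
  qed
  have "finite ?V" "?V \<noteq> {}"
    using G by (simp_all add: fin_graph_iff)
  from build[OF this(1) subset_refl this(2)] obtain e where "cw_valid e" "cw_linear e" "cw_verts e = ?V"
    "cw_arcs e = parcs G \<inter> (?V \<times> ?V)" "cw_labels e \<subseteq> {..k}"
    by auto
  moreover have "parcs G \<inter> (?V \<times> ?V) = parcs G"
    using G by (auto simp: fin_graph_iff)
  ultimately show ?thesis
    by (intro exI[of _ e]) (simp add: cw_graph_def)
qed

lemma lcwd_le_of_order:
  fixes \<kappa> :: "'a \<Rightarrow> 'b::linorder"
  assumes "fin_graph G" and "inj_on \<kappa> (pverts G)"
    and "\<And>S. S \<subseteq> pverts G \<Longrightarrow> S \<noteq> {} \<Longrightarrow> (\<And>u w. u \<in> S \<Longrightarrow> w \<in> pverts G - S \<Longrightarrow> \<kappa> u < \<kappa> w) \<Longrightarrow>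
      card ((\<lambda>u. {w \<in> pverts G - S. (u, w) \<in> parcs G}) ` S) \<le> k"
  shows "lcwd G \<le> Suc k"
proof -
  obtain e where e: "cw_valid e" "cw_linear e" "cw_graph e = G" "cw_labels e \<subseteq> {..k}"
    using cw_linear_expr_of_order[of G \<kappa> k] assms by blast
  have "lcwd G \<le> card (cw_labels e)"
    unfolding lcwd_def using e by (intro Least_le) blast
  also have "\<dots> \<le> card {..k}"
    using e by (intro card_mono) auto
  finally show ?thesis by simp
qed

text \<open>Shows that the minima defining \<open>cwd\<close> and \<open>lcwd\<close> range over
  nonempty sets. Any order works, with the number of vertices as a crude bound on the number of
  neighbourhoods.\<close>

lemma fin_graph_linear_expr:
  assumes "fin_graph G"
  shows "\<exists>e. cw_valid e \<and> cw_linear e \<and> cw_graph e = G"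
proof -
  have fin: "finite (pverts G)"
    using assms by (simp add: fin_graph_iff)
  obtain \<kappa> :: "'a \<Rightarrow> nat" where "inj_on \<kappa> (pverts G)"
    using finite_imp_inj_to_nat_seg[OF fin] by blast
  moreover have "card ((\<lambda>u. {w \<in> pverts G - S. (u, w) \<in> parcs G}) ` S) \<le> card (pverts G)"
    if "S \<subseteq> pverts G" for S
    using that fin by (meson card_image_le card_mono finite_subset order_trans)
  ultimately show ?thesis
    using cw_linear_expr_of_order[OF assms, of \<kappa> "card (pverts G)"] by blast
qed

lemma cwd_expr:
  assumes "fin_graph G"
  shows "\<exists>e. cw_valid e \<and> cw_graph e = G \<and> card (cw_labels e) = cwd G"
proof -
  have "\<exists>k e. cw_valid e \<and> cw_graph e = G \<and> card (cw_labels e) = k"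
    using fin_graph_linear_expr[OF assms] by blast
  from LeastI_ex[OF this] show ?thesis
    unfolding cwd_def .
qed

lemma cwd_le_lcwd:
  assumes "fin_graph G"
  shows "cwd G \<le> lcwd G"
proof -
  have "\<exists>k e. cw_valid e \<and> cw_linear e \<and> cw_graph e = G \<and> card (cw_labels e) = k"
    using fin_graph_linear_expr[OF assms] by blast
  from LeastI_ex[OF this] have
    "\<exists>e. cw_valid e \<and> cw_linear e \<and> cw_graph e = G \<and> card (cw_labels e) = lcwd G"
    unfolding lcwd_def .
  then show ?thesis
    unfolding cwd_def by (intro Least_le) blast
qed

section \<open>Unbounded clique-width\<close>

lemma P_graph_adj:
  "((i, j), (k, l)) \<in> parcs (P_graph \<alpha>) \<longleftrightarrow> 1 \<le> i \<and> 1 \<le> j \<and> 1 \<le> k \<and> 1 \<le> l \<and>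
    (P_step \<alpha> (i, j) (k, l) \<or> P_step \<alpha> (k, l) (i, j))"
  by (auto simp: P_graph_def P_verts_def)

lemma P_graph_sym: "(u, v) \<in> parcs (P_graph \<alpha>) \<longleftrightarrow> (v, u) \<in> parcs (P_graph \<alpha>)"
  by (auto simp: P_graph_def)

text \<open>A cut with few labels is lopsided. Apart from at most \<open>3 * k * (2 * k)\<close>
  rows, each with \<open>N\<close> vertices, the whole grid lies on one side.\<close>

lemma grid_cut:
  fixes A :: "(nat \<times> nat) set" and l :: "nat \<times> nat \<Rightarrow> 'l"
  defines "S n N \<equiv> {1..n} \<times> {1..N}"
  assumes bin: "binary_word \<alpha>" and A: "A \<subseteq> S n N"
    and L: "finite L" "card L \<le> k" "l ` A \<subseteq> L"
    and same: "\<And>u v w. u \<in> A \<Longrightarrow> v \<in> A \<Longrightarrow> l u = l v \<Longrightarrow> w \<in> S n N - A \<Longrightarrow>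
      (u, w) \<in> parcs (P_graph \<alpha>) \<longleftrightarrow> (v, w) \<in> parcs (P_graph \<alpha>)"
    and ones: "3 * k < card {j \<in> {1..<N}. \<alpha> j = 1}" and n: "3 \<le> n"
  shows "card A \<le> 6 * k * k * N \<or> card (S n N - A) \<le> 6 * k * k * N"
proof -
  define D where "D j = {i \<in> {1..n}. (i, j) \<in> A \<longleftrightarrow> (i, Suc j) \<notin> A}" for j
  define E where "E = {j \<in> {1..<N}. \<exists>u w. u \<in> A \<and> w \<in> S n N - A \<and> (u, w) \<in> parcs (P_graph \<alpha>) \<and>
    (snd u = j \<and> snd w = Suc j \<or> snd u = Suc j \<and> snd w = j)}"
  have bit: "\<alpha> j = 0 \<or> \<alpha> j = 1" if "1 \<le> j" for j
    using bin that by (auto simp: binary_word_def)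
  have cardD: "card (D j) \<le> 2 * k" if j: "j \<in> {1..<N}" for j
  proof -
    let ?D1 = "{i \<in> {1..n}. (i, j) \<in> A \<and> (i, Suc j) \<notin> A}"
    let ?D2 = "{i \<in> {1..n}. (i, Suc j) \<in> A \<and> (i, j) \<notin> A}"
    \<comment> \<open>The vertex \<open>(i, Suc j)\<close> lies outside \<open>A\<close> and its
      adjacency tells row \<open>i\<close> of column \<open>j\<close> from every other row, whether
      the columns are matched or co-matched. So distinct rows in \<open>?D1\<close> need distinct
      labels.\<close>
    have inj1: "inj_on (\<lambda>i. l (i, j)) ?D1"
    proof (rule inj_onI)
      fix i i' assume i: "i \<in> ?D1" "i' \<in> ?D1" "l (i, j) = l (i', j)"
      then have "((i, j), (i, Suc j)) \<in> parcs (P_graph \<alpha>) \<longleftrightarrow>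
          ((i', j), (i, Suc j)) \<in> parcs (P_graph \<alpha>)"
        using j by (intro same) (auto simp: S_def)
      then show "i = i'"
        using i j bit[of j] by (auto simp: P_graph_adj)
    qed
    have "(\<lambda>i. l (i, j)) ` ?D1 \<subseteq> L"
      using L by auto
    from card_inj_on_le[OF inj1 this L(1)] L(2) have 1: "card ?D1 \<le> k"
      by (rule le_trans)
    have inj2: "inj_on (\<lambda>i. l (i, Suc j)) ?D2"
    proof (rule inj_onI)
      fix i i' assume i: "i \<in> ?D2" "i' \<in> ?D2" "l (i, Suc j) = l (i', Suc j)"
      then have "((i, Suc j), (i, j)) \<in> parcs (P_graph \<alpha>) \<longleftrightarrow>
          ((i', Suc j), (i, j)) \<in> parcs (P_graph \<alpha>)"
        using j by (intro same) (auto simp: S_def)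
      then show "i = i'"
        using i j bit[of j] by (auto simp: P_graph_adj)
    qed
    have "(\<lambda>i. l (i, Suc j)) ` ?D2 \<subseteq> L"
      using L by auto
    from card_inj_on_le[OF inj2 this L(1)] L(2) have 2: "card ?D2 \<le> k"
      by (rule le_trans)
    have "D j = ?D1 \<union> ?D2"
      by (auto simp: D_def)
    then show ?thesis
      using 1 2 card_Un_le[of ?D1 ?D2] by simp
  qed
  have "card E \<le> 3 * k"
  proof -
    have "\<forall>j\<in>E. \<exists>u w. u \<in> A \<and> w \<in> S n N - A \<and> (u, w) \<in> parcs (P_graph \<alpha>) \<and>
        (snd u = j \<and> snd w = Suc j \<or> snd u = Suc j \<and> snd w = j)"
      by (simp add: E_def)
    then obtain a b where ab: "\<And>j. j \<in> E \<Longrightarrow> a j \<in> A \<and> b j \<in> S n N - A \<and>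
        (a j, b j) \<in> parcs (P_graph \<alpha>) \<and>
        (snd (a j) = j \<and> snd (b j) = Suc j \<or> snd (a j) = Suc j \<and> snd (b j) = j)"
      by metis
    have close: "snd v \<le> Suc (snd w) \<and> snd w \<le> Suc (snd v)" if "(v, w) \<in> parcs (P_graph \<alpha>)" for v w
      using that by (cases v; cases w) (auto simp: P_graph_adj)
    \<comment> \<open>If \<open>a j\<close> and \<open>a j'\<close> share a label, each is adjacent
      to the other's partner, so \<open>j\<close> and \<open>j'\<close> differ by at most 2; equal
      residues modulo 3 then make them equal.\<close>
    have "inj_on (\<lambda>j. (l (a j), j mod 3)) E"
    proof (rule inj_onI)
      fix j j' assume j: "j \<in> E" "j' \<in> E" "(l (a j), j mod 3) = (l (a j'), j' mod 3)"
      then have "(a j', b j) \<in> parcs (P_graph \<alpha>)" "(a j, b j') \<in> parcs (P_graph \<alpha>)"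
        using same[of "a j" "a j'" "b j"] same[of "a j'" "a j" "b j'"] ab by auto
      then have "j' \<le> j + 2" "j \<le> j' + 2"
        using close[of "a j'" "b j"] close[of "a j" "b j'"] ab[OF j(1)] ab[OF j(2)] by linarith+
      moreover have "j mod 3 = j' mod 3"
        using j by simp
      ultimately show "j = j'"
        by presburger
    qed
    moreover have "(\<lambda>j. (l (a j), j mod 3)) ` E \<subseteq> L \<times> {..<3}"
      using ab L by auto
    ultimately have "card E \<le> card (L \<times> {..<3::nat})"
      using L by (intro card_inj_on_le) auto
    also have "\<dots> \<le> 3 * k"
      using L by (simp add: card_cartesian_product)
    finally show ?thesis .
  qed
  have inact: "(i, j) \<in> A \<longleftrightarrow> (i', Suc j) \<in> A"
    if "j \<in> {1..<N} - E" "i \<in> {1..n}" "i' \<in> {1..n}" "((i, j), (i', Suc j)) \<in> parcs (P_graph \<alpha>)" for i i' j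
  proof -
    have "((i', Suc j), (i, j)) \<in> parcs (P_graph \<alpha>)"
      using that(4) P_graph_sym by blast
    then show ?thesis
      using that unfolding E_def S_def by fastforce
  qed
  \<comment> \<open>A co-matching on at least three rows is connected, so without edges across the
    cut both columns lie on one side. The rows \<open>y\<close> and \<open>z\<close> provide
    explicit connecting paths.\<close>
  have inact1: "((i, j) \<in> A \<longleftrightarrow> (i, Suc j) \<in> A) \<and> ((i, j) \<in> A \<longleftrightarrow> (1, j) \<in> A)"
    if j: "j \<in> {1..<N} - E" "\<alpha> j = 1" and i: "i \<in> {1..n}" for i j
  proof -
    have step: "(x, j) \<in> A \<longleftrightarrow> (y, Suc j) \<in> A" if "x \<noteq> y" "x \<in> {1..n}" "y \<in> {1..n}" for x y
      using inact[OF j(1) that(2,3)] that j by (auto simp: P_graph_adj)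
    have "\<exists>y\<in>{1, 2, 3}. y \<noteq> i \<and> y \<noteq> 1"
      by auto
    then obtain y where y: "y \<in> {1, 2, 3}" "y \<noteq> i" "y \<noteq> 1" by blast
    have "\<exists>z\<in>{1, 2, 3}. z \<noteq> i \<and> z \<noteq> y"
      by auto
    then obtain z where z: "z \<in> {1, 2, 3}" "z \<noteq> i" "z \<noteq> y" by blast
    have yz: "y \<in> {1..n}" "z \<in> {1..n}" "1 \<in> {1..n}"
      using n y z by auto
    have "(i, j) \<in> A \<longleftrightarrow> (y, Suc j) \<in> A" "(1, j) \<in> A \<longleftrightarrow> (y, Suc j) \<in> A"
      "(z, j) \<in> A \<longleftrightarrow> (y, Suc j) \<in> A" "(z, j) \<in> A \<longleftrightarrow> (i, Suc j) \<in> A"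
      using step[of i y] step[of 1 y] step[of z y] step[of z i] i y z yz by auto
    then show ?thesis by blast
  qed
  have D_empty: "D j = {}" if j: "j \<in> {1..<N} - E" for j
  proof -
    have "(i, j) \<in> A \<longleftrightarrow> (i, Suc j) \<in> A" if i: "i \<in> {1..n}" for i
    proof (cases "\<alpha> j = 1")
      case True
      then show ?thesis
        using inact1[OF j True i] by blast
    next
      case False
      then have "\<alpha> j = 0"
        using bit[of j] j by auto
      then show ?thesis
        using inact[OF j i i] i j by (auto simp: P_graph_adj)
    qed
    then show ?thesis
      by (auto simp: D_def)
  qed
  define C where "C = (\<Union>j\<in>E. D j)"
  have finE: "finite E" and EN: "E \<subseteq> {1..<N}"
    by (auto simp: E_def)
  have finC: "finite C"
    unfolding C_def using finE by (auto simp: D_def)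
  have "card C \<le> (\<Sum>j\<in>E. card (D j))"
    unfolding C_def by (rule card_UN_le[OF finE])
  also have "\<dots> \<le> (\<Sum>j\<in>E. 2 * k)"
    using cardD EN by (intro sum_mono) blast
  also have "\<dots> \<le> (3 * k) * (2 * k)"
    using \<open>card E \<le> 3 * k\<close> by simp
  finally have cardC: "card C \<le> 6 * k * k"
    by simp
  have row: "(i, Suc j) \<in> A \<longleftrightarrow> (i, 1) \<in> A" if i: "i \<in> {1..n} - C" and "Suc j \<le> N" for i j
    using that(2)
  proof (induction j)
    case 0
    then show ?case by simp
  next
    case (Suc j)
    have "i \<notin> D (Suc j)"
      using i Suc.prems D_empty[of "Suc j"] by (cases "Suc j \<in> E") (auto simp: C_def)
    then show ?case
      using Suc i by (auto simp: D_def)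
  qed
  have row': "(i, j) \<in> A \<longleftrightarrow> (i, j') \<in> A"
    if "i \<in> {1..n} - C" "j \<in> {1..N}" "j' \<in> {1..N}" for i j j'
    using row[OF that(1), of "j - 1"] row[OF that(1), of "j' - 1"] that by auto
  \<comment> \<open>There are more than \<open>3 * k\<close> co-matched pairs of columns, so one has
    no edge across the cut; it fixes a common side for all rows outside \<open>C\<close>.\<close>
  have "\<not> {j \<in> {1..<N}. \<alpha> j = 1} \<subseteq> E"
    using card_mono[OF finE] ones \<open>card E \<le> 3 * k\<close> by (metis le_trans not_le)
  then obtain j where j: "j \<in> {1..<N} - E" "\<alpha> j = 1"
    by auto
  have colour: "(i, j') \<in> A \<longleftrightarrow> (1, j) \<in> A" if "i \<in> {1..n} - C" "j' \<in> {1..N}" for i j'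
    using row'[OF that, of j] inact1[OF j, of i] that j by auto
  have small: "card X \<le> 6 * k * k * N" if "X \<subseteq> C \<times> {1..N}" for X
  proof -
    have "card X \<le> card (C \<times> {1..N})"
      using that finC by (intro card_mono) auto
    also have "\<dots> \<le> 6 * k * k * N"
      using cardC by (simp add: card_cartesian_product)
    finally show ?thesis .
  qed
  show ?thesis
  proof (cases "(1, j) \<in> A")
    case True
    have "S n N - A \<subseteq> C \<times> {1..N}"
    proof clarify
      fix x y assume "(x, y) \<in> S n N" "(x, y) \<notin> A"
      then show "x \<in> C \<and> y \<in> {1..N}"
        using colour[of x y] True by (auto simp: S_def)
    qed
    then show ?thesis
      using small by blast
  next
    case False
    have "A \<subseteq> C \<times> {1..N}"
    proof clarify
      fix x y assume xy: "(x, y) \<in> A"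
      then have "(x, y) \<in> S n N"
        using A by blast
      then show "x \<in> C \<and> y \<in> {1..N}"
        using colour[of x y] False xy by (auto simp: S_def)
    qed
    then show ?thesis
      using small by blast
  qed
qed

lemma not_bounded_cwd_G_class:
  assumes bin: "binary_word \<alpha>" and ones: "\<And>K. \<exists>N. K \<le> card {j \<in> {1..<N}. \<alpha> j = 1}"
  shows "\<not> bounded_param cwd (G_class \<alpha>)"
proof
  assume "bounded_param cwd (G_class \<alpha>)"
  then obtain c where c: "\<And>G. G \<in> G_class \<alpha> \<Longrightarrow> cwd G \<le> c"
    by (auto simp: bounded_param_def)
  \<comment> \<open>The successor keeps \<open>k\<close> positive, so that \<open>m\<close> below is
    at least 1 even if \<open>c = 0\<close>.\<close>
  define k where "k = Suc c"
  obtain N where N: "3 * k + 1 \<le> card {j \<in> {1..<N}. \<alpha> j = 1}"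
    using ones by blast
  then have N1: "1 \<le> N"
    by (cases N) auto
  \<comment> \<open>Chosen so that the grid has \<open>3 * m + 3 * N\<close> vertices for
    \<open>m = 6 * k * k * N\<close>: a side with more than \<open>m\<close> and at most
    \<open>2 * m\<close> vertices leaves more than \<open>m\<close> on the other.\<close>
  define n where "n = 18 * k * k + 3"
  define S where "S = {1..n} \<times> {1..N}"
  have cardS: "card S = n * N" and finS: "finite S"
    by (simp_all add: S_def card_cartesian_product)
  define H where "H = \<lparr> pverts = S, parcs = parcs (P_graph \<alpha>) \<inter> (S \<times> S) \<rparr>"
  have "S \<noteq> {}"
    using N1 by (auto simp: S_def n_def)
  moreover have "sym (parcs (P_graph \<alpha>) \<inter> (S \<times> S))"
    using P_graph_sym by (auto simp: sym_def)
  moreover have "irrefl (parcs (P_graph \<alpha>) \<inter> (S \<times> S))"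
    by (auto simp: irrefl_def P_graph_adj)
  ultimately have H: "fin_graph H"
    using finS by (auto simp: fin_graph_iff H_def)
  have "S \<subseteq> P_verts"
    by (auto simp: S_def P_verts_def)
  then have embH: "embedding id H (P_graph \<alpha>)"
    by (auto simp: embedding_def H_def P_graph_def)
  \<comment> \<open>The class consists of graphs on natural numbers, so the grid is copied along the
    pairing function and the cut is later pulled back.\<close>
  define G where "G = image_graph prod_encode H"
  have inj: "inj_on prod_encode (pverts H)"
    by (simp add: inj_prod_encode)
  have G: "fin_graph G"
    unfolding G_def using H inj by (rule fin_graph_image_graph)
  have "G \<in> G_class \<alpha>"
    using isomorphic_imp_embedding[OF H isomorphic_image_graph(1)[OF H inj]] G
      embedding_trans[OF _ embH] by (auto simp: G_class_iff G_def)
  then have "cwd G \<le> c"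
    by (rule c)
  obtain e where e: "cw_valid e" "cw_graph e = G" "card (cw_labels e) = cwd G"
    using cwd_expr[OF G] by blast
  have verts: "cw_verts e = prod_encode ` S" and
    arcs: "cw_arcs e = map_prod prod_encode prod_encode ` (parcs (P_graph \<alpha>) \<inter> (S \<times> S))"
    using e(2) unfolding cw_graph_def G_def H_def image_graph_def by auto
  define m where "m = 6 * k * k * N"
  have m: "1 \<le> m"
    using N1 by (simp add: m_def k_def)
  have nN: "card S = 3 * m + 3 * N"
    unfolding cardS n_def m_def by (simp add: algebra_simps)
  have "m < card (cw_verts e)"
    unfolding verts using nN N1 by (simp add: card_image inj_prod_encode)
  from cw_balanced_cut[OF e(1) m this] obtain B l where B: "B \<subseteq> cw_verts e" "m < card B"
    "card B \<le> 2 * m" "l ` B \<subseteq> cw_labels e" and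
    cut: "\<forall>u\<in>B. \<forall>v\<in>B. l u = l v \<longrightarrow> cw_label e u = cw_label e v \<and>
      (\<forall>w\<in>cw_verts e - B. (u, w) \<in> cw_arcs e \<longleftrightarrow> (v, w) \<in> cw_arcs e)"
    by (elim exE conjE)
  have same: "(u, w) \<in> cw_arcs e \<longleftrightarrow> (v, w) \<in> cw_arcs e"
    if "u \<in> B" "v \<in> B" "l u = l v" "w \<in> cw_verts e - B" for u v w
    using cut that by blast
  define A where "A = {u \<in> S. prod_encode u \<in> B}"
  have BA: "B = prod_encode ` A"
    using B(1) by (auto simp: A_def verts)
  then have cardA: "card A = card B"
    by (simp add: card_image inj_prod_encode)
  have arc: "(prod_encode u, prod_encode w) \<in> cw_arcs e \<longleftrightarrow> (u, w) \<in> parcs (P_graph \<alpha>)"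
    if "u \<in> S" "w \<in> S" for u w
  proof -
    have "(prod_encode u, prod_encode w) = map_prod prod_encode prod_encode x \<longleftrightarrow> x = (u, w)" for x
      by (cases x) auto
    then show ?thesis
      unfolding arcs image_iff using that by simp
  qed
  have "card A \<le> 6 * k * k * N \<or> card ({1..n} \<times> {1..N} - A) \<le> 6 * k * k * N"
  proof (rule grid_cut[OF bin, where l = "l \<circ> prod_encode" and L = "cw_labels e"])
    show "A \<subseteq> {1..n} \<times> {1..N}"
      by (auto simp: A_def S_def)
    show "card (cw_labels e) \<le> k"
      using e \<open>cwd G \<le> c\<close> by (simp add: k_def)
    show "(l \<circ> prod_encode) ` A \<subseteq> cw_labels e"
      using B(4) by (auto simp: A_def)
    show "3 * k < card {j \<in> {1..<N}. \<alpha> j = 1}" "3 \<le> n"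
      using N by (simp_all add: n_def)
  next
    fix u v w assume u: "u \<in> A" "v \<in> A" "(l \<circ> prod_encode) u = (l \<circ> prod_encode) v"
      "w \<in> {1..n} \<times> {1..N} - A"
    then have w: "w \<in> S" "u \<in> S" "v \<in> S" "prod_encode w \<in> cw_verts e - B"
      using u(1,2,4) unfolding S_def[symmetric] by (auto simp: A_def verts)
    have "prod_encode u \<in> B" "prod_encode v \<in> B"
      using u by (simp_all add: A_def)
    from same[OF this _ w(4)] show "(u, w) \<in> parcs (P_graph \<alpha>) \<longleftrightarrow> (v, w) \<in> parcs (P_graph \<alpha>)"
      using u(3) arc w by simp
  qed simp
  moreover have "card (S - A) = card S - card A"
    using finS by (intro card_Diff_subset) (auto simp: A_def)
  then have "card (S - A) > m" "card A > m"
    using nN B(2,3) N1 unfolding cardA by linarith+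
  ultimately show False
    unfolding m_def S_def by linarith
qed

section \<open>Repetition of letters in periodic words\<close>

lemma periodic_shift:
  fixes \<alpha> :: "nat \<Rightarrow> 'a"
  assumes "\<And>i. 1 \<le> i \<Longrightarrow> \<alpha> i = \<alpha> (i + p)" and "1 \<le> i"
  shows "\<alpha> (i + p * t) = \<alpha> i"
proof (induction t)
  case (Suc t)
  have "\<alpha> (i + p * Suc t) = \<alpha> (i + p * t + p)"
    by (simp add: algebra_simps)
  also have "\<dots> = \<alpha> (i + p * t)"
    using assms(1)[of "i + p * t"] assms(2) by simp
  finally show ?case
    using Suc by simp
qed simp

lemma periodic_many_ones:
  assumes "periodic_word \<alpha>" and "1 \<le> i" and "\<alpha> i = a"
  shows "\<exists>N. K \<le> card {j \<in> {1..<N}. \<alpha> j = a}"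
proof -
  obtain p where p: "1 \<le> p" "\<And>i. 1 \<le> i \<Longrightarrow> \<alpha> i = \<alpha> (i + p)"
    using assms(1) by (auto simp: periodic_word_def)
  let ?N = "i + p * K + 1"
  have "(\<lambda>t. i + p * t) ` {..<K} \<subseteq> {j \<in> {1..<?N}. \<alpha> j = a}"
  proof (rule image_subsetI)
    fix t assume "t \<in> {..<K}"
    then have "p * t \<le> p * K"
      by simp
    then have "i + p * t \<in> {1..<?N}"
      using assms(2) unfolding atLeastLessThan_iff by linarith
    then show "i + p * t \<in> {j \<in> {1..<?N}. \<alpha> j = a}"
      using periodic_shift[of \<alpha> p i t, OF p(2) assms(2)] assms(3) by blast
  qed
  moreover have "inj_on (\<lambda>t. i + p * t) {..<K}"
    using p(1) by (auto simp: inj_on_def)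
  ultimately have "card {..<K} \<le> card {j \<in> {1..<?N}. \<alpha> j = a}"
    by (intro card_inj_on_le) auto
  then show ?thesis
    by auto
qed

section \<open>Bounded linear clique-width of proper subclasses\<close>

lemma embedding_factor:
  assumes "embedding f G K" and h: "embedding h H K" and "f ` pverts G \<subseteq> h ` pverts H"
  shows "embedding (the_inv_into (pverts H) h \<circ> f) G H"
proof -
  let ?g = "the_inv_into (pverts H) h"
  have inj: "inj_on h (pverts H)"
    using h by (simp add: embedding_def)
  have g: "?g (f u) \<in> pverts H" "h (?g (f u)) = f u" if "u \<in> pverts G" for u
    using that assms(3) the_inv_into_into[OF inj, of "f u"] f_the_inv_into_f[OF inj, of "f u"]
    by blast+
  have "inj_on (?g \<circ> f) (pverts G)"
    using assms(1) g(2) by (simp add: embedding_def inj_on_def) metis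
  then show ?thesis
    using assms(1) h g by (simp add: embedding_def image_subset_iff)
qed

locale row_cuts =
  fixes W :: "(nat \<times> nat) set" and T :: nat
  assumes T_pos: "0 < T"
begin

text \<open>The rows that are complete in block \<open>b\<close>. When \<open>W\<close> consists of
  vertices of the infinite grid, \<open>full 0\<close> is empty, because block 0 contains column
  0.\<close>

definition full :: "nat \<Rightarrow> nat set" where
  "full b = {i. \<forall>c. c div T = b \<longrightarrow> (i, c) \<in> W}"

text \<open>
  Block \<open>b\<close> consists of the columns \<open>c\<close> with \<open>c div T = b\<close>; column \<open>0\<close> contains no vertex. The cut of
  a row in a block is a missing vertex if there is one, and the start of the block otherwise.
\<close>

definition cut :: "nat \<Rightarrow> nat \<Rightarrow> nat" where
  "cut i b = (if i \<in> full b then b * T else SOME c. c div T = b \<and> (i, c) \<notin> W)"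

text \<open>The number of the piece of row \<open>i\<close> containing column \<open>c\<close>:
  piece \<open>b\<close> runs from the cut in block \<open>b - 1\<close>, inclusive, to the cut in
  block \<open>b\<close>, exclusive.\<close>

definition key :: "nat \<times> nat \<Rightarrow> nat" where
  "key = (\<lambda>(i, c). if c < cut i (c div T) then c div T else Suc (c div T))"

lemma cut_div: "cut i b div T = b"
  and cut_in: "(i, cut i b) \<in> W \<Longrightarrow> i \<in> full b"
proof -
  have "cut i b div T = b \<and> (i, cut i b) \<notin> W" if "i \<notin> full b"
  proof -
    have "\<exists>c. c div T = b \<and> (i, c) \<notin> W"
      using that by (auto simp: full_def)
    from someI_ex[OF this] show ?thesis
      using that by (simp add: cut_def)
  qed
  note not_full = this
  show "cut i b div T = b"
    using not_full T_pos by (cases "i \<in> full b") (simp_all add: cut_def)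
  show "(i, cut i b) \<in> W \<Longrightarrow> i \<in> full b"
    using not_full by blast
qed

lemma Suc_div_cases: "Suc c div T = c div T \<or> Suc c div T = Suc (c div T) \<and> Suc c = Suc (c div T) * T"
proof (cases "Suc c mod T = 0")
  case True
  then have "Suc c div T = Suc (c div T)"
    by (simp add: div_Suc)
  moreover have "Suc c = Suc c div T * T"
    using True by (simp add: dvd_eq_mod_eq_0[symmetric])
  ultimately show ?thesis
    by simp
next
  case False
  then show ?thesis
    by (simp add: div_Suc)
qed

lemma key_bounds: "c div T \<le> key (i, c)" "key (i, c) \<le> Suc (c div T)"
  by (auto simp: key_def)

text \<open>The piece changes only if \<open>Suc c\<close> is the cut of its block. At a block
  boundary the earlier cut is already passed, so a change again puts the new cut at
  \<open>Suc c\<close>. A cut belonging to \<open>W\<close> occurs only in a full row.\<close>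

lemma key_change_imp_full:
  assumes "(i, Suc c) \<in> W" and "key (i, c) \<noteq> key (i, Suc c)"
  shows "i \<in> full (Suc c div T)"
proof -
  have "cut i (Suc c div T) = Suc c"
  proof (cases "Suc c div T = c div T")
    case True
    then show ?thesis
      using assms(2) by (auto simp: key_def split: if_splits)
  next
    case False
    then have S: "Suc c div T = Suc (c div T)" "Suc c = Suc (c div T) * T"
      using Suc_div_cases by blast+
    have "cut i (c div T) < Suc c"
      using cut_div[of i "c div T"] S by (metis div_le_mono leI not_less_eq_eq order_refl)
    then have "key (i, c) = Suc (c div T)"
      by (simp add: key_def)
    then have "cut i (Suc c div T) \<le> Suc c"
      using assms(2) S(1) by (auto simp: key_def split: if_splits)
    moreover have "Suc c \<le> cut i (Suc c div T)"
      using cut_div[of i "Suc c div T"] S T_pos by (metis times_div_less_eq_dividend mult.commute)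
    ultimately show ?thesis
      by simp
  qed
  then show ?thesis
    using assms(1) cut_in[of i "Suc c div T"] by simp
qed

end

text \<open>Vertices are listed by piece, then row, then column. For an initial segment,
  \<open>q\<close> determines the remaining neighbourhood: \<open>3 * T\<close> columns times
  \<open>4 * n + 2\<close> row values, and one value for vertices with no remaining neighbour. The
  outer successor is the spare label.\<close>

lemma (in row_cuts) lcwd_le_of_full:
  assumes bin: "binary_word \<alpha>" and H: "fin_graph H" and h: "embedding h H (P_graph \<alpha>)"
    and W: "W = h ` pverts H" and n: "\<And>b. finite (full b) \<and> card (full b) \<le> n"
  shows "lcwd H \<le> Suc (Suc (3 * T * (4 * n + 2)))"
proof (rule lcwd_le_of_order[OF H, where \<kappa> = "\<lambda>v. (key (h v), h v)"])
  have inj: "inj_on h (pverts H)"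
    using h by (simp add: embedding_def)
  then show "inj_on (\<lambda>v. (key (h v), h v)) (pverts H)"
    by (auto simp: inj_on_def)
  fix S assume S: "S \<subseteq> pverts H" "S \<noteq> {}" and
    init: "\<And>u w. u \<in> S \<Longrightarrow> w \<in> pverts H - S \<Longrightarrow> (key (h u), h u) < (key (h w), h w)"
  let ?\<kappa> = "\<lambda>v. (key (h v), h v)"
  let ?N = "\<lambda>u. {w \<in> pverts H - S. (u, w) \<in> parcs H}"
  have finS: "finite S"
    using S(1) H finite_subset by (auto simp: fin_graph_iff)
  have "Max (?\<kappa> ` S) \<in> ?\<kappa> ` S"
    using finS S(2) by (intro Max_in) auto
  then obtain x where x: "x \<in> S" "Max (?\<kappa> ` S) = ?\<kappa> x"
    by blast
  have le_x: "?\<kappa> u \<le> ?\<kappa> x" if "u \<in> S" for u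
    using that finS Max_ge[of "?\<kappa> ` S" "?\<kappa> u"] by (simp add: x(2)[symmetric])
  have x_less: "?\<kappa> x < ?\<kappa> w" if "w \<in> pverts H - S" for w
    using init[OF x(1) that] .
  define K where "K = key (h x)"
  \<comment> \<open>The exceptional rows: that of the last listed vertex \<open>x\<close>, whose
    current piece may be only partly listed, and the full rows of the blocks in which a piece may
    change near the boundary. The upper end \<open>K + 1\<close> allows for a neighbour one block
    beyond \<open>K\<close>.\<close>
  define R where "R = insert (fst (h x)) (\<Union>b\<in>{K - 2..K + 1}. full b)"
  define C where "C = {(K - 2) * T..<(K + 1) * T}"
  have key_le: "key (h u) \<le> K" if "u \<in> S" for u
    using le_x[OF that] by (auto simp: K_def)
  have key_ge: "K \<le> key (h w)" if "w \<in> pverts H - S" for w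
    using x_less[OF that] by (auto simp: K_def)
  \<comment> \<open>A listed vertex has key at most \<open>K\<close>, which bounds its block by
    \<open>K\<close>. An unlisted one has key at least \<open>K\<close>, hence block at least
    \<open>K - 1\<close>, and a vertex in an adjacent column is at most one block earlier.\<close>
  have window: "K - 2 \<le> c div T \<and> c div T \<le> K"
    if u: "u \<in> S" "h u = (i, c)" and w: "w \<in> pverts H - S" "h w = (k, d)"
      and cd: "d = Suc c \<or> c = Suc d" for u w i c k d
  proof -
    have "c div T \<le> K"
      using key_le[OF u(1)] key_bounds(1)[of c i] u(2) by simp
    moreover have "K \<le> Suc (d div T)"
      using key_ge[OF w(1)] key_bounds(2)[of k d] w(2) by simp
    moreover have "d div T \<le> Suc (c div T)"
      using cd
    proof
      assume "d = Suc c"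
      then show ?thesis
        using Suc_div_cases[of c] by (elim disjE) simp_all
    next
      assume "c = Suc d"
      then have "d div T \<le> c div T"
        by (intro div_le_mono) simp
      then show ?thesis
        by simp
    qed
    ultimately show ?thesis
      by linarith
  qed
  \<comment> \<open>If both vertices lie in one piece, its number is \<open>K\<close>, and the
    lexicographic order places \<open>x\<close> between them, in the same row. Otherwise the piece
    changes between their columns, which requires a full row.\<close>
  have same_row: "i \<in> R"
    if u: "u \<in> S" "h u = (i, c)" and w: "w \<in> pverts H - S" "h w = (i, d)"
      and cd: "d = Suc c \<or> c = Suc d" for u w i c d
  proof (cases "key (i, c) = key (i, d)")
    case True
    then have "key (h u) = K" "key (h w) = K"
      using key_le[OF u(1)] key_ge[OF w(1)] u(2) w(2) by auto
    then have "h u \<le> h x" "h x < h w"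
      using le_x[OF u(1)] x_less[OF w(1)] by (simp_all add: K_def)
    then have "fst (h x) = i"
      using u(2) w(2) by (cases "h x") auto
    then show ?thesis
      by (simp add: R_def)
  next
    case False
    have in_W: "(i, c) \<in> W" "(i, d) \<in> W"
      using u w S(1) unfolding W by (metis DiffD1 image_eqI subsetD)+
    have "i \<in> full (max c d div T)"
      using cd False in_W key_change_imp_full[of i c] key_change_imp_full[of i d]
      by (auto simp: max_def)
    moreover have "max c d div T \<in> {K - 2..K + 1}"
    proof -
      have "max c d div T = c div T \<or> max c d div T = Suc (c div T)"
        using cd Suc_div_cases[of c] by (elim disjE) simp_all
      then show ?thesis
        using window[OF u w cd] by auto
    qed
    ultimately show ?thesis
      by (auto simp: R_def)
  qed
  \<comment> \<open>Row 0 contains no vertex, so 0 can stand for all rows outside \<open>R\<close>.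
    Columns outside \<open>C\<close> contain no listed vertex with an unlisted neighbour.\<close>
  define q where "q = (\<lambda>u. if snd (h u) \<in> C then
    Some (snd (h u), if fst (h u) \<in> R then fst (h u) else 0) else None)"
  have pos: "1 \<le> fst (h u) \<and> 1 \<le> snd (h u)" if "u \<in> pverts H" for u
    using h that by (auto simp: embedding_def P_graph_def P_verts_def image_subset_iff)
  have sub: "?N u \<subseteq> ?N v" if u: "u \<in> S" and v: "v \<in> S" and quv: "q u = q v" for u v
  proof
    fix w assume "w \<in> ?N u"
    then have w: "w \<in> pverts H - S" "(u, w) \<in> parcs H"
      by auto
    obtain i c where hu: "h u = (i, c)" by fastforce
    obtain i' c' where hv: "h v = (i', c')" by fastforce
    obtain k d where hw: "h w = (k, d)" by fastforce
    have uV: "u \<in> pverts H" "v \<in> pverts H" "w \<in> pverts H"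
      using S u v w by auto
    have adj: "((i, c), (k, d)) \<in> parcs (P_graph \<alpha>)"
      using h w(2) uV hu hw by (auto simp: embedding_def)
    then have cd: "d = Suc c \<or> c = Suc d"
      by (auto simp: P_graph_adj)
    have "c \<in> C"
      using window[OF u hu w(1) hw cd] T_pos
      unfolding C_def by (simp add: less_eq_div_iff_mult_less_eq div_less_iff_less_mult[symmetric] del: mult_Suc)
    then have c': "c' = c" and ii: "(if i \<in> R then i else 0) = (if i' \<in> R then i' else 0)"
      using quv by (auto simp: q_def hu hv split: if_splits)
    show "w \<in> ?N v"
    proof (cases "i \<in> R")
      case True
      then have "i' = i"
        using ii pos[OF uV(1)] hu by (auto split: if_splits)
      then have "u = v"
        using inj_onD[OF inj, of u v] uV hu hv c' by simp
      then show ?thesis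
        using w by simp
    next
      case False
      then have i': "i' \<notin> R"
        using ii pos[OF uV(2)] hv by (auto split: if_splits)
      \<comment> \<open>\<open>same_row\<close> concerns adjacent columns rather than adjacent
        vertices, so it applies to \<open>v\<close> as well. With both rows different from
        \<open>k\<close>, adjacency to \<open>w\<close> depends on the columns alone.\<close>
      have "k \<noteq> i" "k \<noteq> i'"
        using False i' same_row[OF u hu w(1) _ cd] same_row[OF v _ w(1) _ cd] hw hv c' by auto
      then have "((i', c), (k, d)) \<in> parcs (P_graph \<alpha>)"
        using adj pos[OF uV(2)] hv by (auto simp: P_graph_adj)
      then have "(v, w) \<in> parcs H"
        using h uV hv hw c' by (auto simp: embedding_def)
      then show ?thesis
        using w(1) by simp
    qed
  qed
  have "?N u = ?N v" if "u \<in> S" "v \<in> S" "q u = q v" for u v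
    using sub[OF that] sub[OF that(2,1) that(3)[symmetric]] by (rule equalityI)
  then have "card (?N ` S) \<le> card (q ` S)"
    by (rule card_image_le_card_image[OF finS])
  also have "\<dots> \<le> card (insert None (Some ` (C \<times> insert 0 R)))"
    using n by (intro card_mono) (auto simp: q_def C_def R_def)
  also have "\<dots> \<le> Suc (card (C \<times> insert 0 R))"
    using n by (simp add: card_insert_if card_image R_def C_def)
  also have "\<dots> \<le> Suc (3 * T * (4 * n + 2))"
  proof -
    have "card (\<Union>b\<in>{K - 2..K + 1}. full b) \<le> (\<Sum>b\<in>{K - 2..K + 1}. card (full b))"
      by (rule card_UN_le) simp
    also have "\<dots> \<le> (\<Sum>b\<in>{K - 2..K + 1}. n)"
      using n by (intro sum_mono) blast
    also have "\<dots> = (Suc (K + 1) - (K - 2)) * n"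
      by simp
    also have "\<dots> \<le> 4 * n"
      by (rule mult_le_mono1) linarith
    finally have "card (insert 0 R) \<le> 4 * n + 2"
      using n by (simp add: R_def card_insert_if)
    moreover have "card C \<le> 3 * T"
    proof -
      have "(K + 1) * T \<le> (K - 2 + 3) * T"
        by (intro mult_le_mono1) simp
      then show ?thesis
        by (simp add: C_def algebra_simps)
    qed
    ultimately show ?thesis
      unfolding card_cartesian_product Suc_le_mono by (rule mult_le_mono[rotated])
  qed
  finally show "card (?N ` S) \<le> Suc (3 * T * (4 * n + 2))" .
qed

text \<open>An omitted graph \<open>G\<close> occupying \<open>n\<close> rows and \<open>m\<close>
  columns would embed into any member with at least \<open>n\<close> full rows in some block. Hence
  every block has few full rows, with a bound depending only on \<open>G\<close> and the
  period.\<close>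

lemma bounded_lcwd_proper_subclass:
  assumes bin: "binary_word \<alpha>" and "periodic_word \<alpha>"
    and Y: "hereditary Y" "Y \<subset> G_class \<alpha>"
  shows "bounded_param lcwd Y"
proof -
  obtain p where p: "1 \<le> p" "\<And>i. 1 \<le> i \<Longrightarrow> \<alpha> i = \<alpha> (i + p)"
    using assms(2) by (auto simp: periodic_word_def)
  obtain G where G: "G \<in> G_class \<alpha>" "G \<notin> Y"
    using Y(2) by blast
  then obtain g where finG: "fin_graph G" and g: "embedding g G (P_graph \<alpha>)"
    by (auto simp: G_class_iff)
  have fin: "finite (g ` pverts G)"
    using finG by (simp add: fin_graph_iff)
  define n where "n = Max (fst ` g ` pverts G)"
  define m where "m = Max (snd ` g ` pverts G)"
  have range: "1 \<le> i \<and> i \<le> n \<and> 1 \<le> j \<and> j \<le> m" if "u \<in> pverts G" "g u = (i, j)" for u i j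
  proof -
    have ij: "(i, j) \<in> g ` pverts G"
      using that by force
    have "i \<le> n" "j \<le> m"
      unfolding n_def m_def using fin imageI[OF ij, of fst] imageI[OF ij, of snd]
      by (simp_all add: Max_ge)
    moreover have "(i, j) \<in> P_verts"
      using g ij unfolding embedding_def P_graph_def by auto
    ultimately show ?thesis
      by (simp add: P_verts_def)
  qed
  \<comment> \<open>A multiple of the period, so that shifting by whole blocks preserves the word,
    and larger than \<open>m\<close>, so that columns 1 to \<open>m\<close> shifted by
    \<open>b * T\<close> stay within block \<open>b\<close>.\<close>
  define T where "T = p * Suc m"
  have "1 * Suc m \<le> T"
    unfolding T_def using p(1) by (rule mult_le_mono1)
  then have T_bounds: "0 < T" "m < T"
    by simp_all
  have "lcwd H \<le> Suc (Suc (3 * T * (4 * n + 2)))" if HY: "H \<in> Y" for H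
  proof -
    have "H \<in> G_class \<alpha>"
      using HY Y(2) by blast
    then obtain h where H: "fin_graph H" and h: "embedding h H (P_graph \<alpha>)"
      unfolding G_class_iff by blast
    define W where "W = h ` pverts H"
    have finW: "finite W"
      using H by (simp add: W_def fin_graph_iff)
    interpret row_cuts W T
      by unfold_locales (rule T_bounds(1))
    have "finite (full b) \<and> card (full b) \<le> n" for b
    proof -
      have "full b \<subseteq> fst ` W"
      proof
        fix i assume "i \<in> full b"
        then have "(i, b * T) \<in> W"
          using T_bounds(1) by (simp add: full_def)
        then show "i \<in> fst ` W"
          by force
      qed
      then have finf: "finite (full b)"
        using finW finite_surj by blast
      moreover have "card (full b) \<le> n"
      proof (rule ccontr)
        assume "\<not> card (full b) \<le> n"
        then have "card {1..n} \<le> card (full b)"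
          by simp
        then obtain r where r: "inj_on r {1..n}" "r ` {1..n} \<subseteq> full b"
          using card_le_inj[of "{1..n}" "full b"] finf by auto
        \<comment> \<open>Places the rows of \<open>G\<close> in full rows of block \<open>b\<close>
          and shifts its columns there. Adjacency only compares row numbers, so any injection of
          rows preserves it.\<close>
        define \<phi> where "\<phi> = (\<lambda>(i, j). (r i, j + b * T))"
        have \<phi>W: "\<phi> (i, j) \<in> W" if "1 \<le> i \<and> i \<le> n \<and> 1 \<le> j \<and> j \<le> m" for i j
        proof -
          have "r i \<in> full b"
            using r(2) that by auto
          moreover have "(j + b * T) div T = b"
            using le_less_trans[OF _ T_bounds(2), of j] that T_bounds(1) by simp
          ultimately show ?thesis
            by (auto simp: full_def \<phi>_def)
        qed
        have W_verts: "1 \<le> i \<and> 1 \<le> j" if "(i, j) \<in> W" for i j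
          using h that by (auto simp: W_def embedding_def P_graph_def P_verts_def)
        have shift: "\<alpha> (j + b * T) = \<alpha> j" if "1 \<le> j" for j
          using periodic_shift[of \<alpha> p j "Suc m * b", OF p(2) that] by (simp add: T_def algebra_simps)
        have "embedding (\<phi> \<circ> g) G (P_graph \<alpha>)"
          unfolding embedding_def
        proof (intro conjI ballI)
          show "inj_on (\<phi> \<circ> g) (pverts G)"
          proof (rule inj_onI)
            fix u v assume uv: "u \<in> pverts G" "v \<in> pverts G" "(\<phi> \<circ> g) u = (\<phi> \<circ> g) v"
            obtain i j where gu: "g u = (i, j)" by fastforce
            obtain k l where gv: "g v = (k, l)" by fastforce
            have "g u = g v"
              using uv(3) inj_onD[OF r(1), of i k] range[OF uv(1) gu] range[OF uv(2) gv]
              by (simp add: gu gv \<phi>_def)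
            then show "u = v"
              using g uv by (auto simp: embedding_def dest: inj_onD)
          qed
          show "(\<phi> \<circ> g) ` pverts G \<subseteq> pverts (P_graph \<alpha>)"
          proof (rule image_subsetI)
            fix u assume u: "u \<in> pverts G"
            obtain i j where gu: "g u = (i, j)" by fastforce
            then show "(\<phi> \<circ> g) u \<in> pverts (P_graph \<alpha>)"
              using \<phi>W[OF range[OF u gu]] h
              by (auto simp: W_def embedding_def)
          qed
        next
          fix u v assume uv: "u \<in> pverts G" "v \<in> pverts G"
          obtain i j where gu: "g u = (i, j)" by fastforce
          obtain k l where gv: "g v = (k, l)" by fastforce
          note ranges = range[OF uv(1) gu] range[OF uv(2) gv]
          have "r i = r k \<longleftrightarrow> i = k"
            using ranges r(1) by (auto simp: inj_on_eq_iff)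
          moreover have "1 \<le> r i" "1 \<le> r k"
            using W_verts \<phi>W ranges by (auto simp: \<phi>_def)
          ultimately have "((i, j), (k, l)) \<in> parcs (P_graph \<alpha>) \<longleftrightarrow> (\<phi> (i, j), \<phi> (k, l)) \<in> parcs (P_graph \<alpha>)"
            using ranges shift[of j] shift[of l] by (auto simp: P_graph_adj \<phi>_def)
          then show "(u, v) \<in> parcs G \<longleftrightarrow> ((\<phi> \<circ> g) u, (\<phi> \<circ> g) v) \<in> parcs (P_graph \<alpha>)"
            using g uv gu gv by (simp add: embedding_def)
        qed
        moreover have "(\<phi> \<circ> g) ` pverts G \<subseteq> h ` pverts H"
        proof (rule image_subsetI)
          fix u assume u: "u \<in> pverts G"
          obtain i j where gu: "g u = (i, j)" by fastforce
          then show "(\<phi> \<circ> g) u \<in> h ` pverts H"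
            using \<phi>W[OF range[OF u gu]] by (simp add: W_def)
        qed
        ultimately have "embedding (the_inv_into (pverts H) h \<circ> (\<phi> \<circ> g)) G H"
          using embedding_factor h by blast
        then have "G \<in> Y"
          by (rule hereditary_embedding[OF Y(1) HY finG])
        then show False
          using G(2) by simp
      qed
      ultimately show ?thesis ..
    qed
    from lcwd_le_of_full[OF bin H h W_def this] show ?thesis .
  qed
  then show ?thesis
    by (auto simp: bounded_param_def)
qed

theorem theorem1:
  fixes \<alpha> :: "nat \<Rightarrow> nat"
  assumes "binary_word \<alpha>"
    and "periodic_word \<alpha>"
    and "\<exists>i\<ge>1. \<alpha> i = 1"
  shows "minimal_hereditary_unbounded cwd (G_class \<alpha>) \<and>
         minimal_hereditary_unbounded lcwd (G_class \<alpha>)"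
proof -
  have fin: "fin_graph G" if "G \<in> G_class \<alpha>" for G
    using that by (simp add: G_class_iff)
  have cwd: "\<not> bounded_param cwd (G_class \<alpha>)"
    using not_bounded_cwd_G_class[OF assms(1)] periodic_many_ones[OF assms(2)] assms(3) by blast
  \<comment> \<open>Since \<open>cwd\<close> is at most \<open>lcwd\<close>, unboundedness of the
    former and bounds on the latter settle both statements.\<close>
  have le: "bounded_param cwd X" if "bounded_param lcwd X" "X \<subseteq> G_class \<alpha>" for X
    using that fin cwd_le_lcwd unfolding bounded_param_def by (meson le_trans subsetD)
  then have "\<not> bounded_param lcwd (G_class \<alpha>)"
    using cwd by blast
  moreover have "bounded_param lcwd Y" if "hereditary Y" "Y \<subset> G_class \<alpha>" for Y
    using bounded_lcwd_proper_subclass[OF assms(1,2) that] .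
  ultimately show ?thesis
    using cwd le hereditary_G_class unfolding minimal_hereditary_unbounded_def by blast
qed

end
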